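(* Let $J,M\geq1$ be standard natural numbers, let $G=\mathbb{Z}^d\times G_0$ where $G_0$ is an explicit finite abelian group, and let $N>M$. For each $m=1,\dots,M$ let $F_1^{(m)},\dots,F_J^{(m)}$ be finite non-empty subsets of $G$ and $E_0^{(m)}$ a subset of $G_0$. Define $\tilde F_j\coloneqq\biguplus_{m=1}^M F_j^{(m)}\times\{m\}\subset G\times\mathbb{Z}_N$ for $j=1,\dots,J$ and $\tilde E_0\coloneqq\biguplus_{m=1}^M E_0^{(m)}\times\{m\}\subset G_0\times\mathbb{Z}_N$ (with $m$ viewed as a residue mod $N$, and $\mathbb{Z}^d\times\tilde E_0$ viewed as a subset of $G\times\mathbb{Z}_N$). Then: (i) the system of tiling equations $\operatorname{Tile}(F_1^{(m)},\dots,F_J^{(m)};\mathbb{Z}^d\times E_0^{(m)})$, $m=1,\dots,M$, is aperiodic if and only if the tiling equation $\operatorname{Tile}(\tilde F_1,\dots,\tilde F_J;\mathbb{Z}^d\times\tilde E_0)$ is aperiodic; (ii) that system is undecidable if and only if the tiling equation $\operatorname{Tile}(\tilde F_1,\dots,\tilde F_J;\mathbb{Z}^d\times\tilde E_0)$ is undecidable.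
   Context: An explicit finite abelian group is $\mathbb{Z}_{N_1}\times\dots\times\mathbb{Z}_{N_m}$ with standard positive $N_i$, $\mathbb{Z}_N=\mathbb{Z}/N\mathbb{Z}$. A subset of an abelian group is periodic if it is a finite union of cosets of a finite-index subgroup. For subsets $A,F$, $A\oplus F$ is $\{a+f\}$ if all sums $a+f$ are distinct and undefined otherwise; $A\uplus B$ is $A\cup B$ if disjoint and undefined otherwise; equations with undefined terms are false. The tiling equation $\operatorname{Tile}(F_1,\dots,F_J;E)$ is $\biguplus_{j=1}^J X_j\oplus F_j=E$ in unknowns $X_1,\dots,X_J$. A system of such equations (for $m=1,\dots,M$, with common unknowns $X_1,\dots,X_J$) is undecidable if the first-order sentence asserting a common solution exists is not provable in ZFC (equivalently, as the paper puts it, a common solution exists in some universes of ZFC and not in others); it is aperiodic if, in the standard universe, a common solution exists but none with all $X_j$ periodic. *)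

theory Defs
  imports "HOL-Algebra.Elementary_Groups" "HOL-Algebra.Product_Groups" "HOL-Library.Disjoint_Sets"
begin

section \<open>Explicit groups and tiling equations\<close>

definition int_power_group :: "nat \<Rightarrow> (nat \<Rightarrow> int) monoid" where
  "int_power_group d = product_group {..<d} (\<lambda>_. integer_group)"

definition explicit_finite_group :: "nat list \<Rightarrow> (nat \<Rightarrow> int) monoid" where
  "explicit_finite_group Ns = product_group {..<length Ns} (\<lambda>i. integer_mod_group (Ns ! i))"

type_synonym elem = "(nat \<Rightarrow> int) \<times> (nat \<Rightarrow> int)"

definition explicit_group :: "nat \<Rightarrow> nat list \<Rightarrow> elem monoid" where
  "explicit_group d Ns = int_power_group d \<times>\<times> explicit_finite_group Ns"

definition periodic :: "('a, 'b) monoid_scheme \<Rightarrow> 'a set \<Rightarrow> bool" where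
  "periodic G A \<longleftrightarrow> (\<exists>H C. subgroup H G \<and> finite (rcosets\<^bsub>G\<^esub> H) \<and>
     finite C \<and> C \<subseteq> rcosets\<^bsub>G\<^esub> H \<and> A = \<Union>C)"

definition direct_sum_defined :: "('a, 'b) monoid_scheme \<Rightarrow> 'a set \<Rightarrow> 'a set \<Rightarrow> bool" where
  "direct_sum_defined G A F \<longleftrightarrow> inj_on (\<lambda>(a, f). a \<otimes>\<^bsub>G\<^esub> f) (A \<times> F)"

text \<open>\<open>X\<close> solves \<open>Tile(F 1, ..., F J; E)\<close>: all the terms of the equation are defined, and it holds.\<close>

definition solves_tile ::
  "('a, 'b) monoid_scheme \<Rightarrow> nat \<Rightarrow> (nat \<Rightarrow> 'a set) \<Rightarrow> 'a set \<Rightarrow> (nat \<Rightarrow> 'a set) \<Rightarrow> bool" where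
  "solves_tile G J F E X \<longleftrightarrow>
     (\<forall>j\<in>{1..J}. X j \<subseteq> carrier G) \<and>
     (\<forall>j\<in>{1..J}. direct_sum_defined G (X j) (F j)) \<and>
     disjoint_family_on (\<lambda>j. X j <#>\<^bsub>G\<^esub> F j) {1..J} \<and>
     (\<Union>j\<in>{1..J}. X j <#>\<^bsub>G\<^esub> F j) = E"

text \<open>In a system, \<open>F m j\<close> is the \<open>j\<close>-th tile of the \<open>m\<close>-th equation, whose right-hand side is
  \<open>\<int>\<^sup>d \<times> E0 m\<close>.\<close>

definition solves_system ::
  "nat \<Rightarrow> nat list \<Rightarrow> nat \<Rightarrow> nat \<Rightarrow> (nat \<Rightarrow> nat \<Rightarrow> elem set) \<Rightarrow> (nat \<Rightarrow> (nat \<Rightarrow> int) set)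
     \<Rightarrow> (nat \<Rightarrow> elem set) \<Rightarrow> bool" where
  "solves_system d Ns J M F E0 X \<longleftrightarrow>
     (\<forall>m\<in>{1..M}. solves_tile (explicit_group d Ns) J (F m) (carrier (int_power_group d) \<times> E0 m) X)"

definition aperiodic_system ::
  "nat \<Rightarrow> nat list \<Rightarrow> nat \<Rightarrow> nat \<Rightarrow> (nat \<Rightarrow> nat \<Rightarrow> elem set) \<Rightarrow> (nat \<Rightarrow> (nat \<Rightarrow> int) set) \<Rightarrow> bool" where
  "aperiodic_system d Ns J M F E0 \<longleftrightarrow>
     (\<exists>X. solves_system d Ns J M F E0 X) \<and>
     \<not> (\<exists>X. solves_system d Ns J M F E0 X \<and> (\<forall>j\<in>{1..J}. periodic (explicit_group d Ns) (X j)))"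

definition aperiodic_tile ::
  "nat \<Rightarrow> nat list \<Rightarrow> nat \<Rightarrow> (nat \<Rightarrow> elem set) \<Rightarrow> (nat \<Rightarrow> int) set \<Rightarrow> bool" where
  "aperiodic_tile d Ns J F E0 \<longleftrightarrow> aperiodic_system d Ns J 1 (\<lambda>_. F) (\<lambda>_. E0)"

text \<open>If \<open>G\<^sub>0\<close> is the explicit group with moduli \<open>Ns\<close>, then \<open>G\<^sub>0 \<times> \<int>\<^sub>N\<close> is the explicit group with
  moduli \<open>Ns @ [N]\<close>; the pair of \<open>a\<close> and the residue of \<open>m\<close> is \<open>a\<close> with the residue stored as
  the last coordinate.\<close>

definition append_residue :: "nat list \<Rightarrow> nat \<Rightarrow> (nat \<Rightarrow> int) \<Rightarrow> nat \<Rightarrow> (nat \<Rightarrow> int)" where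
  "append_residue Ns N a m = a(length Ns := int m mod int N)"

definition stacked_tile ::
  "nat list \<Rightarrow> nat \<Rightarrow> nat \<Rightarrow> (nat \<Rightarrow> nat \<Rightarrow> elem set) \<Rightarrow> nat \<Rightarrow> elem set" where
  "stacked_tile Ns N M F j = (\<Union>m\<in>{1..M}. (\<lambda>(z, a). (z, append_residue Ns N a m)) ` F m j)"

definition stacked_set ::
  "nat list \<Rightarrow> nat \<Rightarrow> nat \<Rightarrow> (nat \<Rightarrow> (nat \<Rightarrow> int) set) \<Rightarrow> (nat \<Rightarrow> int) set" where
  "stacked_set Ns N M E0 = (\<Union>m\<in>{1..M}. (\<lambda>a. append_residue Ns N a m) ` E0 m)"


section \<open>First-order logic of set theory\<close>

text \<open>Variables are de Bruijn indices: \<open>All\<close> binds index 0 of its body. The only terms are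
  variables, so substitution is renaming.\<close>

datatype fm = Mem nat nat | Eq nat nat | Fls | Imp fm fm | All fm

definition Neg :: "fm \<Rightarrow> fm" where "Neg p = Imp p Fls"
definition Dis :: "fm \<Rightarrow> fm \<Rightarrow> fm" where "Dis p q = Imp (Neg p) q"
definition Con :: "fm \<Rightarrow> fm \<Rightarrow> fm" where "Con p q = Neg (Imp p (Neg q))"
definition Iff :: "fm \<Rightarrow> fm \<Rightarrow> fm" where "Iff p q = Con (Imp p q) (Imp q p)"
definition Ex :: "fm \<Rightarrow> fm" where "Ex p = Neg (All (Neg p))"

definition Con_list :: "fm list \<Rightarrow> fm" where "Con_list ps = foldr Con ps (Neg Fls)"
definition Dis_list :: "fm list \<Rightarrow> fm" where "Dis_list ps = foldr Dis ps Fls"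

text \<open>Conjunction and disjunction over a finite set, enumerated in an arbitrary order.\<close>

definition Con_over :: "'a set \<Rightarrow> ('a \<Rightarrow> fm) \<Rightarrow> fm" where
  "Con_over A p = Con_list (map p (SOME xs. set xs = A))"

definition Dis_over :: "'a set \<Rightarrow> ('a \<Rightarrow> fm) \<Rightarrow> fm" where
  "Dis_over A p = Dis_list (map p (SOME xs. set xs = A))"

primrec free_vars :: "fm \<Rightarrow> nat set" where
  "free_vars (Mem x y) = {x, y}"
| "free_vars (Eq x y) = {x, y}"
| "free_vars Fls = {}"
| "free_vars (Imp p q) = free_vars p \<union> free_vars q"
| "free_vars (All p) = {x. Suc x \<in> free_vars p}"

definition sentence :: "fm \<Rightarrow> bool" where "sentence p \<longleftrightarrow> free_vars p = {}"

primrec rename :: "(nat \<Rightarrow> nat) \<Rightarrow> fm \<Rightarrow> fm" where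
  "rename r (Mem x y) = Mem (r x) (r y)"
| "rename r (Eq x y) = Eq (r x) (r y)"
| "rename r Fls = Fls"
| "rename r (Imp p q) = Imp (rename r p) (rename r q)"
| "rename r (All p) = All (rename (case_nat 0 (\<lambda>x. Suc (r x))) p)"

definition inst :: "nat \<Rightarrow> fm \<Rightarrow> fm" where
  "inst t p = rename (case_nat t (\<lambda>x. x)) p"

text \<open>Classical natural deduction with equality.\<close>

inductive derives :: "fm set \<Rightarrow> fm \<Rightarrow> bool" (infix "\<turnstile>" 50) where
  Assm: "p \<in> \<Gamma> \<Longrightarrow> \<Gamma> \<turnstile> p"
| ImpI: "insert p \<Gamma> \<turnstile> q \<Longrightarrow> \<Gamma> \<turnstile> Imp p q"
| ImpE: "\<Gamma> \<turnstile> Imp p q \<Longrightarrow> \<Gamma> \<turnstile> p \<Longrightarrow> \<Gamma> \<turnstile> q"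
| Contr: "insert (Neg p) \<Gamma> \<turnstile> Fls \<Longrightarrow> \<Gamma> \<turnstile> p"
| AllI: "rename Suc ` \<Gamma> \<turnstile> p \<Longrightarrow> \<Gamma> \<turnstile> All p"
| AllE: "\<Gamma> \<turnstile> All p \<Longrightarrow> \<Gamma> \<turnstile> inst t p"
| EqI: "\<Gamma> \<turnstile> Eq t t"
| EqE: "\<Gamma> \<turnstile> Eq s t \<Longrightarrow> \<Gamma> \<turnstile> inst s p \<Longrightarrow> \<Gamma> \<turnstile> inst t p"


section \<open>Set-theoretic vocabulary\<close>

text \<open>The arguments of these abbreviating formulas are variables; they are shifted when passing
  under quantifiers.\<close>

definition Subset :: "nat \<Rightarrow> nat \<Rightarrow> fm" where
  "Subset x y = All (Imp (Mem 0 (x+1)) (Mem 0 (y+1)))"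

definition Empty :: "nat \<Rightarrow> fm" where
  "Empty x = All (Neg (Mem 0 (x+1)))"

text \<open>\<open>z = {x, y}\<close>\<close>
definition UPair :: "nat \<Rightarrow> nat \<Rightarrow> nat \<Rightarrow> fm" where
  "UPair x y z = All (Iff (Mem 0 (z+1)) (Dis (Eq 0 (x+1)) (Eq 0 (y+1))))"

text \<open>\<open>z = {{x, x}, {x, y}}\<close>\<close>
definition OPair :: "nat \<Rightarrow> nat \<Rightarrow> nat \<Rightarrow> fm" where
  "OPair x y z = Ex (Ex (Con_list [UPair (x+2) (x+2) 1, UPair (x+2) (y+2) 0, UPair 1 0 (z+2)]))"

text \<open>\<open>y = x \<union> {x}\<close>\<close>
definition Succ :: "nat \<Rightarrow> nat \<Rightarrow> fm" where
  "Succ x y = All (Iff (Mem 0 (y+1)) (Dis (Mem 0 (x+1)) (Eq 0 (x+1))))"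

definition Inductive :: "nat \<Rightarrow> fm" where
  "Inductive w = Con (Ex (Con (Empty 0) (Mem 0 (w+1))))
     (All (Imp (Mem 0 (w+1)) (Ex (Con (Succ 1 0) (Mem 0 (w+2))))))"

text \<open>\<open>x \<in> \<omega>\<close>\<close>
definition Natural :: "nat \<Rightarrow> fm" where
  "Natural x = All (Imp (Inductive 0) (Mem (x+1) 0))"


section \<open>The axioms of ZFC\<close>

definition Extensionality :: fm where
  "Extensionality = All (All (Imp (All (Iff (Mem 0 2) (Mem 0 1))) (Eq 1 0)))"

definition Foundation :: fm where
  "Foundation = All (Imp (Ex (Mem 0 1)) (Ex (Con (Mem 0 1) (Neg (Ex (Con (Mem 0 2) (Mem 0 1)))))))"

definition Pairing :: fm where
  "Pairing = All (All (Ex (UPair 2 1 0)))"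

definition Union_axiom :: fm where
  "Union_axiom = All (Ex (All (Iff (Mem 0 1) (Ex (Con (Mem 0 3) (Mem 1 0))))))"

definition Powerset :: fm where
  "Powerset = All (Ex (All (Iff (Mem 0 1) (Subset 0 2))))"

definition Infinity :: fm where
  "Infinity = Ex (Inductive 0)"

text \<open>Every set of nonempty pairwise disjoint sets has a transversal.\<close>

definition Choice :: fm where
  "Choice = All (Imp
     (Con (All (Imp (Mem 0 1) (Ex (Mem 0 1))))
          (All (All (Imp (Con_list [Mem 1 2, Mem 0 2, Ex (Con (Mem 0 2) (Mem 0 1))]) (Eq 1 0)))))
     (Ex (All (Imp (Mem 0 2) (Ex (All (Iff (Con (Mem 0 2) (Mem 0 3)) (Eq 0 1))))))))"

text \<open>\<open>\<forall>a. \<exists>b. \<forall>x. x \<in> b \<longleftrightarrow> x \<in> a \<and> p x a\<close>. In \<open>p\<close>, index 0 is \<open>x\<close>, index 1 is \<open>a\<close>, and the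
  remaining indices are parameters.\<close>

definition Separation :: "fm \<Rightarrow> fm" where
  "Separation p = All (Ex (All (Iff (Mem 0 1) (Con (Mem 0 2) (rename (case_nat 0 (\<lambda>i. i+2)) p)))))"

text \<open>\<open>\<forall>a. (\<forall>x\<in>a. \<forall>y y'. p y x a \<and> p y' x a \<longrightarrow> y = y') \<longrightarrow> (\<exists>b. \<forall>y. y \<in> b \<longleftrightarrow> (\<exists>x\<in>a. p y x a))\<close>.
  In \<open>p\<close>, index 0 is \<open>y\<close>, index 1 is \<open>x\<close>, index 2 is \<open>a\<close>, and the remaining indices are
  parameters.\<close>

definition Replacement :: "fm \<Rightarrow> fm" where
  "Replacement p = All (Imp
     (All (Imp (Mem 0 1) (All (All (Imp
        (Con (rename Suc p) (rename (case_nat 0 (\<lambda>i. i+2)) p)) (Eq 1 0))))))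
     (Ex (All (Iff (Mem 0 1)
        (Ex (Con (Mem 0 3) (rename (case_nat 1 (case_nat 0 (\<lambda>i. i+3))) p)))))))"

text \<open>\<open>(All ^^ n)\<close> binds the parameters of an instance of a schema.\<close>

definition ZFC :: "fm set" where
  "ZFC = {Extensionality, Foundation, Pairing, Union_axiom, Powerset, Infinity, Choice}
     \<union> {(All ^^ n) (Separation p) | n p. sentence ((All ^^ n) (Separation p))}
     \<union> {(All ^^ n) (Replacement p) | n p. sentence ((All ^^ n) (Replacement p))}"


section \<open>Solvability of a system as a sentence of set theory\<close>

text \<open>Inside set theory, the integer \<open>m\<close> (resp. \<open>-m\<close>), for \<open>m \<in> \<omega>\<close>, is the ordered pair
  \<open>(m, 0)\<close> (resp. \<open>(0, m)\<close>); residues modulo \<open>N\<close> are the von Neumann numerals below \<open>N\<close>;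
  tuples are nested ordered pairs starting from the empty set. Only sums \<open>x + f\<close> with a standard
  (metatheoretic) \<open>f\<close> occur in a tiling equation, so adding an integer constant can be expressed by
  iterating the successor function of \<open>\<int>\<close>.\<close>

primrec Numeral :: "nat \<Rightarrow> nat \<Rightarrow> fm" where
  "Numeral 0 x = Empty x"
| "Numeral (Suc k) x = Ex (Con (Numeral k 0) (Succ 0 (x+1)))"

definition Integer :: "nat \<Rightarrow> fm" where
  "Integer x = Ex (Ex (Con_list [Natural 1, Empty 0, Dis (OPair 1 0 (x+2)) (OPair 0 1 (x+2))]))"

text \<open>\<open>y = x + 1\<close>: either \<open>x = (m, 0)\<close> and \<open>y = (m+1, 0)\<close>, or \<open>x = (0, m+1)\<close> and \<open>y = (0, m)\<close>.\<close>
definition Int_succ :: "nat \<Rightarrow> nat \<Rightarrow> fm" where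
  "Int_succ x y = Ex (Ex (Ex (Con_list [Natural 2, Succ 2 1, Empty 0,
     Dis (Con (OPair 2 0 (x+3)) (OPair 1 0 (y+3))) (Con (OPair 0 1 (x+3)) (OPair 0 2 (y+3)))])))"

primrec Int_add_nat :: "nat \<Rightarrow> nat \<Rightarrow> nat \<Rightarrow> fm" where
  "Int_add_nat 0 x y = Con (Integer x) (Eq x y)"
| "Int_add_nat (Suc n) x y = Ex (Con (Int_succ (x+1) 0) (Int_add_nat n 0 (y+1)))"

text \<open>\<open>x\<close> and \<open>y\<close> are integers with \<open>y = x + c\<close>\<close>
definition Int_add :: "int \<Rightarrow> nat \<Rightarrow> nat \<Rightarrow> fm" where
  "Int_add c x y = (if c \<ge> 0 then Int_add_nat (nat c) x y else Int_add_nat (nat (- c)) y x)"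

definition Residue :: "nat \<Rightarrow> nat \<Rightarrow> fm" where
  "Residue N x = Dis_list (map (\<lambda>k. Numeral k x) [0..<N])"

text \<open>\<open>x\<close> and \<open>y\<close> are residues modulo \<open>N\<close> with \<open>y = x + b\<close>\<close>
definition Residue_add :: "nat \<Rightarrow> int \<Rightarrow> nat \<Rightarrow> nat \<Rightarrow> fm" where
  "Residue_add N b x y =
     Dis_list (map (\<lambda>k. Con (Numeral k x) (Numeral (nat ((int k + b) mod int N)) y)) [0..<N])"

text \<open>\<open>x\<close> is an \<open>n\<close>-tuple whose \<open>i\<close>-th coordinate satisfies \<open>p i\<close>\<close>
primrec Tuple :: "nat \<Rightarrow> (nat \<Rightarrow> nat \<Rightarrow> fm) \<Rightarrow> nat \<Rightarrow> fm" where
  "Tuple 0 p x = Empty x"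
| "Tuple (Suc n) p x = Ex (Ex (Con_list [OPair 1 0 (x+2), Tuple n p 1, p n 0]))"

text \<open>\<open>x\<close> and \<open>y\<close> are \<open>n\<close>-tuples whose \<open>i\<close>-th coordinates are related by \<open>p i\<close>\<close>
primrec Tuple_rel :: "nat \<Rightarrow> (nat \<Rightarrow> nat \<Rightarrow> nat \<Rightarrow> fm) \<Rightarrow> nat \<Rightarrow> nat \<Rightarrow> fm" where
  "Tuple_rel 0 p x y = Con (Empty x) (Empty y)"
| "Tuple_rel (Suc n) p x y = Ex (Ex (Ex (Ex (Con_list
     [OPair 3 2 (x+4), OPair 1 0 (y+4), Tuple_rel n p 3 1, p n 2 0]))))"

text \<open>\<open>x \<in> \<int>\<^sup>d \<times> G\<^sub>0\<close>\<close>
definition In_group :: "nat \<Rightarrow> nat list \<Rightarrow> nat \<Rightarrow> fm" where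
  "In_group d Ns x = Ex (Ex (Con_list [OPair 1 0 (x+2),
     Tuple d (\<lambda>_. Integer) 1, Tuple (length Ns) (\<lambda>i. Residue (Ns ! i)) 0]))"

text \<open>\<open>x, y \<in> \<int>\<^sup>d \<times> G\<^sub>0\<close> and \<open>y = x + f\<close>\<close>
definition Translate :: "nat \<Rightarrow> nat list \<Rightarrow> elem \<Rightarrow> nat \<Rightarrow> nat \<Rightarrow> fm" where
  "Translate d Ns f x y = Ex (Ex (Ex (Ex (Con_list [OPair 3 2 (x+4), OPair 1 0 (y+4),
     Tuple_rel d (\<lambda>i. Int_add (fst f i)) 3 1,
     Tuple_rel (length Ns) (\<lambda>i. Residue_add (Ns ! i) (snd f i)) 2 0]))))"

text \<open>\<open>y \<in> \<int>\<^sup>d \<times> E0\<close>\<close>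
definition In_target :: "nat \<Rightarrow> nat list \<Rightarrow> (nat \<Rightarrow> int) set \<Rightarrow> nat \<Rightarrow> fm" where
  "In_target d Ns E0 y = Ex (Ex (Con_list [OPair 1 0 (y+2), Tuple d (\<lambda>_. Integer) 1,
     Dis_over E0 (\<lambda>a. Tuple (length Ns) (\<lambda>i. Numeral (nat (a i))) 0)]))"

text \<open>In the following four formulas, the unknown \<open>X\<^sub>j\<close> (\<open>1 \<le> j \<le> J\<close>) is the free variable with
  index \<open>j - 1\<close>. First: all sums \<open>x + f\<close> with \<open>x \<in> X\<^sub>j\<close> and \<open>f \<in> F\<close> are distinct.\<close>

definition Sums_distinct :: "nat \<Rightarrow> nat list \<Rightarrow> elem set \<Rightarrow> nat \<Rightarrow> fm" where
  "Sums_distinct d Ns F j = Con_over F (\<lambda>f. Con_over F (\<lambda>f'. All (All (All (Imp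
     (Con_list [Mem 2 (j-1+3), Mem 1 (j-1+3), Translate d Ns f 2 0, Translate d Ns f' 1 0])
     (if f = f' then Eq 2 1 else Fls))))))"

text \<open>\<open>y \<in> X\<^sub>j + F\<close>, where \<open>k\<close> is the number of quantifiers in whose scope this formula is used\<close>
definition In_sum :: "nat \<Rightarrow> nat list \<Rightarrow> elem set \<Rightarrow> nat \<Rightarrow> nat \<Rightarrow> nat \<Rightarrow> fm" where
  "In_sum d Ns F j k y =
     Dis_over F (\<lambda>f. Ex (Con (Mem 0 (j-1+k+1)) (Translate d Ns f 0 (y+1))))"

definition Tile_equation ::
  "nat \<Rightarrow> nat list \<Rightarrow> nat \<Rightarrow> (nat \<Rightarrow> elem set) \<Rightarrow> (nat \<Rightarrow> int) set \<Rightarrow> fm" where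
  "Tile_equation d Ns J F E0 = Con_list
     [Con_list (map (\<lambda>j. Sums_distinct d Ns (F j) j) [1..<Suc J]),
      Con_list [Neg (Ex (Con (In_sum d Ns (F i) i 1 0) (In_sum d Ns (F j) j 1 0))).
              i \<leftarrow> [1..<Suc J], j \<leftarrow> [1..<Suc J], i \<noteq> j],
      All (Iff (Dis_list (map (\<lambda>j. In_sum d Ns (F j) j 1 0) [1..<Suc J])) (In_target d Ns E0 0))]"

definition Solvable ::
  "nat \<Rightarrow> nat list \<Rightarrow> nat \<Rightarrow> nat \<Rightarrow> (nat \<Rightarrow> nat \<Rightarrow> elem set) \<Rightarrow> (nat \<Rightarrow> (nat \<Rightarrow> int) set) \<Rightarrow> fm" where
  "Solvable d Ns J M F E0 = (Ex ^^ J) (Con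
     (Con_list (map (\<lambda>j. All (Imp (Mem 0 (j-1+1)) (In_group d Ns 0))) [1..<Suc J]))
     (Con_list (map (\<lambda>m. Tile_equation d Ns J (F m) (E0 m)) [1..<Suc M])))"


section \<open>Undecidability\<close>

text \<open>The literal definition: existence of a common solution is not provable.\<close>

definition undecidable_system ::
  "nat \<Rightarrow> nat list \<Rightarrow> nat \<Rightarrow> nat \<Rightarrow> (nat \<Rightarrow> nat \<Rightarrow> elem set) \<Rightarrow> (nat \<Rightarrow> (nat \<Rightarrow> int) set) \<Rightarrow> bool" where
  "undecidable_system d Ns J M F E0 \<longleftrightarrow> \<not> ZFC \<turnstile> Solvable d Ns J M F E0"

definition undecidable_tile ::
  "nat \<Rightarrow> nat list \<Rightarrow> nat \<Rightarrow> (nat \<Rightarrow> elem set) \<Rightarrow> (nat \<Rightarrow> int) set \<Rightarrow> bool" where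
  "undecidable_tile d Ns J F E0 \<longleftrightarrow> undecidable_system d Ns J 1 (\<lambda>_. F) (\<lambda>_. E0)"

text \<open>Common solutions exist in some universes of ZFC and not in others. By the completeness theorem
  this says that their existence is neither provable nor refutable, which is stronger than the
  literal definition: if ZFC is consistent, a refutable statement is not provable either.\<close>

definition independent_system ::
  "nat \<Rightarrow> nat list \<Rightarrow> nat \<Rightarrow> nat \<Rightarrow> (nat \<Rightarrow> nat \<Rightarrow> elem set) \<Rightarrow> (nat \<Rightarrow> (nat \<Rightarrow> int) set) \<Rightarrow> bool" where
  "independent_system d Ns J M F E0 \<longleftrightarrow>
     \<not> ZFC \<turnstile> Solvable d Ns J M F E0 \<and> \<not> ZFC \<turnstile> Neg (Solvable d Ns J M F E0)"

definition independent_tile ::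
  "nat \<Rightarrow> nat list \<Rightarrow> nat \<Rightarrow> (nat \<Rightarrow> elem set) \<Rightarrow> (nat \<Rightarrow> int) set \<Rightarrow> bool" where
  "independent_tile d Ns J F E0 \<longleftrightarrow> independent_system d Ns J 1 (\<lambda>_. F) (\<lambda>_. E0)"

end

(* If X solves the system then the sets X_j x {0} solve the stacked equation. Conversely, in a
   solution Y of the stacked equation every point of Y_j has last coordinate 0: otherwise, since
   N > M, some translate of it by the m-th layer of the j-th tile would leave the layers 1, ..., M
   occupied by the right-hand side. So Y_j = X_j x {0}, and comparing layers gives the system. A set
   X is periodic iff X x {0} is.

   The correspondence is definable, hence it also takes place inside every model of ZFC, where all
   that is needed about the model's integers is that addition of a standard constant is total. By
   the completeness theorem the two solvability sentences are then provably equivalent in ZFC, so one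
   of them (or its negation) is provable iff the other is. *)

theory Submission
  imports Defs "HOL-Library.Countable_Set"
begin

section \<open>Completeness for natural-number models\<close>

text \<open>Provability in ZFC concerns all models, and a HOL statement cannot quantify over their
  carrier types. Since ZFC has no finite models, the countable model built from a Henkin set can be
  renumbered to have carrier \<open>nat\<close>, so completeness for structures on this one type
  suffices. Countability of \<open>fm\<close> lets the Henkin construction run through all formulas.
  A model may be nonstandard: neither its integers nor its sets of group elements need be the
  genuine ones. The tiling argument is therefore carried out once for an abstract relation
  \<open>Tr f x y\<close>, where \<open>f\<close> always comes from a genuine finite tile, and
  instantiated twice. The admissible unknowns differ as well: in the standard universe they are all
  subsets, or all periodic ones, whereas in a model they are the subsets coded by an element of the
  model. A pair of predicates \<open>Q\<close>, \<open>Q'\<close> compatible with the passage to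
  layer 0 absorbs this difference; in a model the compatibility comes from Replacement.\<close>

instance fm :: countable
  by countable_datatype

section \<open>Semantics and renaming of variables\<close>

primrec sat :: "('a \<Rightarrow> 'a \<Rightarrow> bool) \<Rightarrow> (nat \<Rightarrow> 'a) \<Rightarrow> fm \<Rightarrow> bool" where
  "sat E v (Mem x y) = E (v x) (v y)"
| "sat E v (Eq x y) = (v x = v y)"
| "sat E v Fls = False"
| "sat E v (Imp p q) = (sat E v p \<longrightarrow> sat E v q)"
| "sat E v (All p) = (\<forall>a. sat E (case_nat a v) p)"

text \<open>With variables as the only terms, this is the substitution lemma; it evaluates the
  renamed formulas inside the axiom schemes.\<close>

lemma sat_rename: "sat E v (rename r p) = sat E (\<lambda>x. v (r x)) p"
proof (induction p arbitrary: v r)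
  case (All p)
  have "(\<lambda>x. case_nat a v (case_nat 0 (\<lambda>x. Suc (r x)) x)) = case_nat a (\<lambda>x. v (r x))" for a
    by (auto split: nat.split)
  then show ?case by (simp add: All)
qed auto

lemma rename_cong: "\<forall>x\<in>free_vars p. r x = s x \<Longrightarrow> rename r p = rename s p"
proof (induction p arbitrary: r s)
  case (All p)
  from All.prems have "\<forall>x\<in>free_vars p. case_nat 0 (\<lambda>x. Suc (r x)) x = case_nat 0 (\<lambda>x. Suc (s x)) x"
    by (auto split: nat.split)
  from All.IH[OF this] show ?case by simp
next
  case (Imp p q)
  from Imp.prems have "\<forall>x\<in>free_vars p. r x = s x" "\<forall>x\<in>free_vars q. r x = s x" by auto
  with Imp.IH show ?case by simp
qed auto

lemma rename_rename: "rename r (rename s p) = rename (\<lambda>x. r (s x)) p"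
proof (induction p arbitrary: r s)
  case (All p)
  show ?case by (simp add: All) (rule rename_cong, auto split: nat.split)
qed auto

lemma rename_ident: "(\<And>x. r x = x) \<Longrightarrow> rename r p = p"
proof (induction p arbitrary: r)
  case (All p)
  show ?case by (auto simp: All split: nat.split)
qed auto

lemma rename_sentence: "sentence p \<Longrightarrow> rename r p = p"
  using rename_cong[of p r id] rename_ident[of id p] by (simp add: sentence_def)

lemma finite_free_vars: "finite (free_vars p)"
proof (induction p)
  case (All p)
  have "{x. Suc x \<in> free_vars p} = Suc -` free_vars p" by auto
  with All show ?case by (simp add: finite_vimageI)
qed auto

lemma rename_inst: "rename r (inst t p) = rename (case_nat (r t) r) p"
  unfolding inst_def rename_rename by (auto intro!: rename_cong split: nat.split)

text \<open>Together with \<open>rename_inst\<close> this shows that renaming commutes with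
  instantiation, as the rules \<open>AllE\<close> and \<open>EqE\<close> require.\<close>

lemma inst_rename_lift: "inst t (rename (case_nat 0 (\<lambda>x. Suc (r x))) p) = rename (case_nat t r) p"
  unfolding inst_def rename_rename by (auto intro!: rename_cong split: nat.split)

section \<open>Structural properties of derivations\<close>

lemma derives_mono: "\<Gamma> \<turnstile> p \<Longrightarrow> \<Gamma> \<subseteq> \<Delta> \<Longrightarrow> \<Delta> \<turnstile> p"
proof (induction arbitrary: \<Delta> rule: derives.induct)
  case (ImpI p \<Gamma> q)
  then show ?case by (meson derives.ImpI insert_mono)
next
  case (Contr p \<Gamma>)
  then show ?case by (meson derives.Contr insert_mono)
next
  case (AllI \<Gamma> p)
  then show ?case by (meson derives.AllI image_mono)
next
  case (EqE \<Gamma> s t p)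
  then show ?case by (meson derives.EqE)
next
  case (ImpE \<Gamma> p q)
  then show ?case by (meson derives.ImpE)
qed (blast intro: derives.intros)+

text \<open>Only finitely many assumptions enter a derivation; this is what keeps the union of an
  increasing chain of consistent sets consistent.\<close>

lemma derives_finite: "\<Gamma> \<turnstile> p \<Longrightarrow> \<exists>\<Delta>\<subseteq>\<Gamma>. finite \<Delta> \<and> \<Delta> \<turnstile> p"
proof (induction rule: derives.induct)
  case (Assm p \<Gamma>)
  then show ?case by (intro exI[of _ "{p}"]) (auto intro: derives.Assm)
next
  case (ImpI p \<Gamma> q)
  then obtain \<Delta> where \<Delta>: "\<Delta> \<subseteq> insert p \<Gamma>" "finite \<Delta>" "\<Delta> \<turnstile> q" by blast
  \<comment> \<open>The discharged \<open>p\<close> may or may not lie in \<open>\<Delta>\<close>;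
    removing and reinserting it gives the shape that \<open>ImpI\<close> expects.\<close>
  from \<Delta>(3) have "insert p (\<Delta> - {p}) \<turnstile> q" by (rule derives_mono) blast
  then have "\<Delta> - {p} \<turnstile> Imp p q" by (rule derives.ImpI)
  with \<Delta> show ?case by (intro exI[of _ "\<Delta> - {p}"]) blast
next
  case (ImpE \<Gamma> p q)
  then obtain \<Delta> \<Delta>' where \<Delta>: "\<Delta> \<subseteq> \<Gamma>" "finite \<Delta>" "\<Delta> \<turnstile> Imp p q"
    and \<Delta>': "\<Delta>' \<subseteq> \<Gamma>" "finite \<Delta>'" "\<Delta>' \<turnstile> p" by blast
  from \<Delta>(3) have "\<Delta> \<union> \<Delta>' \<turnstile> Imp p q" by (rule derives_mono) blast
  moreover from \<Delta>'(3) have "\<Delta> \<union> \<Delta>' \<turnstile> p" by (rule derives_mono) blast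
  ultimately have "\<Delta> \<union> \<Delta>' \<turnstile> q" by (rule derives.ImpE)
  with \<Delta> \<Delta>' show ?case by (intro exI[of _ "\<Delta> \<union> \<Delta>'"]) blast
next
  case (Contr p \<Gamma>)
  then obtain \<Delta> where \<Delta>: "\<Delta> \<subseteq> insert (Neg p) \<Gamma>" "finite \<Delta>" "\<Delta> \<turnstile> Fls" by blast
  from \<Delta>(3) have "insert (Neg p) (\<Delta> - {Neg p}) \<turnstile> Fls" by (rule derives_mono) blast
  then have "\<Delta> - {Neg p} \<turnstile> p" by (rule derives.Contr)
  with \<Delta> show ?case by (intro exI[of _ "\<Delta> - {Neg p}"]) blast
next
  case (AllI \<Gamma> p)
  then obtain \<Delta> where "\<Delta> \<subseteq> rename Suc ` \<Gamma>" "finite \<Delta>" "\<Delta> \<turnstile> p" by blast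
  then show ?case by (metis derives.AllI finite_subset_image)
next
  case (AllE \<Gamma> p t)
  then show ?case by (meson derives.AllE)
next
  case (EqI \<Gamma> t)
  then show ?case by (intro exI[of _ "{}"]) (simp add: derives.EqI)
next
  case (EqE \<Gamma> s t p)
  then obtain \<Delta> \<Delta>' where \<Delta>: "\<Delta> \<subseteq> \<Gamma>" "finite \<Delta>" "\<Delta> \<turnstile> Eq s t"
    and \<Delta>': "\<Delta>' \<subseteq> \<Gamma>" "finite \<Delta>'" "\<Delta>' \<turnstile> inst s p" by blast
  from \<Delta>(3) have "\<Delta> \<union> \<Delta>' \<turnstile> Eq s t" by (rule derives_mono) blast
  moreover from \<Delta>'(3) have "\<Delta> \<union> \<Delta>' \<turnstile> inst s p" by (rule derives_mono) blast
  ultimately have "\<Delta> \<union> \<Delta>' \<turnstile> inst t p" by (rule derives.EqE)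
  with \<Delta> \<Delta>' show ?case by (intro exI[of _ "\<Delta> \<union> \<Delta>'"]) blast
qed

text \<open>The induction has to allow every \<open>r\<close>, because \<open>AllI\<close> passes to
  the renaming lifted under the binder. The purpose is to turn a fresh variable into index
  0.\<close>

lemma derives_rename: "\<Gamma> \<turnstile> p \<Longrightarrow> rename r ` \<Gamma> \<turnstile> rename r p"
proof (induction arbitrary: r rule: derives.induct)
  case (Assm p \<Gamma>)
  then show ?case by (intro derives.Assm) blast
next
  case (ImpI p \<Gamma> q)
  then show ?case by (simp add: derives.ImpI)
next
  case (ImpE \<Gamma> p q)
  then show ?case by (metis derives.ImpE rename.simps(4))
next
  case (Contr p \<Gamma>)
  from Contr.IH[of r] show ?case by (simp add: derives.Contr Neg_def)
next
  case (AllI \<Gamma> p)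
  let ?r = "case_nat 0 (\<lambda>x. Suc (r x))"
  have "rename ?r ` rename Suc ` \<Gamma> = rename Suc ` rename r ` \<Gamma>"
    by (simp add: rename_rename image_comp)
  with AllI.IH[of ?r] show ?case by (simp add: derives.AllI)
next
  case (AllE \<Gamma> p t)
  from derives.AllE[OF AllE.IH[of r, unfolded rename.simps], of "r t"]
  show ?case by (simp add: rename_inst inst_rename_lift)
next
  case (EqI \<Gamma> t)
  then show ?case by (simp add: derives.EqI)
next
  case (EqE \<Gamma> s t p)
  let ?p = "rename (case_nat 0 (\<lambda>x. Suc (r x))) p"
  have inst: "rename r (inst u p) = inst (r u) ?p" for u
    by (simp add: rename_inst inst_rename_lift)
  show ?case
    using derives.EqE[of "rename r ` \<Gamma>" "r s" "r t" ?p] EqE.IH[of r] by (simp add: inst)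
qed

text \<open>Renaming the fresh variable \<open>c\<close> to 0 and shifting the others turns a derivation of the
  instance at \<open>c\<close> into the premise of the introduction rule for \<open>All\<close>.\<close>

lemma derives_generalize:
  assumes "\<Gamma> \<turnstile> inst c p" and fresh: "\<And>q. q \<in> insert (All p) \<Gamma> \<Longrightarrow> c \<notin> free_vars q"
  shows "\<Gamma> \<turnstile> All p"
proof -
  define r where "r x = (if x = c then 0 else Suc x)" for x
  have "rename r (inst c p) = rename id p"
    unfolding rename_inst using fresh[of "All p"]
    by (intro rename_cong) (auto simp: r_def split: nat.split)
  moreover have "rename r ` \<Gamma> = rename Suc ` \<Gamma>"
    using fresh by (intro image_cong refl rename_cong) (auto simp: r_def)
  ultimately have "rename Suc ` \<Gamma> \<turnstile> p"
    using derives_rename[OF assms(1), of r] by (simp add: rename_ident)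
  then show ?thesis by (rule derives.AllI)
qed

section \<open>Henkin sets and their construction\<close>

text \<open>Witnesses are demanded for negated universal formulas because \<open>All\<close> is the
  only primitive quantifier. They are variables, so the language needs no new constants.\<close>

definition henkin :: "fm set \<Rightarrow> bool" where
  "henkin H \<longleftrightarrow> \<not> H \<turnstile> Fls \<and> (\<forall>p. p \<in> H \<or> Neg p \<in> H) \<and>
     (\<forall>q. Neg (All q) \<in> H \<longrightarrow> (\<exists>c. Neg (inst c q) \<in> H))"

text \<open>The invariant that only finitely many variables occur free leaves a fresh variable
  \<open>c\<close>. If adding the witness \<open>Neg (inst c q)\<close> were inconsistent, then
  \<open>inst c q\<close> and, by generalization over \<open>c\<close>, \<open>All q\<close> would
  follow, against the consistency of \<open>Neg (All q)\<close>.\<close>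

lemma henkin_step:
  assumes cons: "\<not> \<Gamma> \<turnstile> Fls" and fin: "finite (\<Union> (free_vars ` \<Gamma>))"
  shows "\<exists>\<Delta>. \<Gamma> \<subseteq> \<Delta> \<and> \<not> \<Delta> \<turnstile> Fls \<and> finite (\<Union> (free_vars ` \<Delta>)) \<and> (p \<in> \<Delta> \<or> Neg p \<in> \<Delta>) \<and>
     (\<forall>q. p = All q \<longrightarrow> Neg p \<in> \<Delta> \<longrightarrow> (\<exists>c. Neg (inst c q) \<in> \<Delta>))"
proof (cases "insert p \<Gamma> \<turnstile> Fls")
  case False
  \<comment> \<open>By consistency the choice of \<open>p\<close> cannot also put
    \<open>Neg p\<close> into the set, so no witness is owed in this branch.\<close>
  have "Neg p \<notin> insert p \<Gamma>"
  proof
    assume "Neg p \<in> insert p \<Gamma>"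
    then have "insert p \<Gamma> \<turnstile> Imp p Fls" by (auto intro: derives.Assm simp: Neg_def)
    moreover have "insert p \<Gamma> \<turnstile> p" by (auto intro: derives.Assm)
    ultimately show False using False derives.ImpE by blast
  qed
  then show ?thesis using False fin
    by (intro exI[of _ "insert p \<Gamma>"]) (auto simp: finite_free_vars)
next
  case True
  let ?\<Delta> = "insert (Neg p) \<Gamma>"
  have c: "\<not> ?\<Delta> \<turnstile> Fls"
    using True cons derives.Contr derives.ImpI derives.ImpE by blast
  have f: "finite (\<Union> (free_vars ` ?\<Delta>))" using fin by (simp add: finite_free_vars)
  show ?thesis
  proof (cases "\<exists>q. p = All q")
    case False
    with c f show ?thesis by (intro exI[of _ ?\<Delta>]) auto
  next
    case True
    then obtain q where q: "p = All q" by blast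
    obtain c where c': "c \<notin> \<Union> (free_vars ` ?\<Delta>)"
      using ex_new_if_finite[OF infinite_UNIV_nat f] by blast
    have "\<not> insert (Neg (inst c q)) ?\<Delta> \<turnstile> Fls"
    proof
      assume "insert (Neg (inst c q)) ?\<Delta> \<turnstile> Fls"
      then have "?\<Delta> \<turnstile> inst c q" by (rule derives.Contr)
      then have "?\<Delta> \<turnstile> All q"
        by (rule derives_generalize) (use c' in \<open>auto simp: q Neg_def\<close>)
      moreover have "?\<Delta> \<turnstile> Imp (All q) Fls" by (auto intro: derives.Assm simp: q Neg_def)
      ultimately show False using c derives.ImpE by blast
    qed
    with f q show ?thesis
      by (intro exI[of _ "insert (Neg (inst c q)) ?\<Delta>"]) (force simp: finite_free_vars)
  qed
qed

text \<open>Lindenbaum's construction: stage \<open>n\<close> decides the formula with number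
  \<open>n\<close> and supplies a witness if one is due.\<close>

lemma henkin_extension:
  assumes "\<not> \<Gamma> \<turnstile> Fls" and "finite (\<Union> (free_vars ` \<Gamma>))"
  shows "\<exists>H. \<Gamma> \<subseteq> H \<and> henkin H"
proof -
  define P where "P \<Delta> \<longleftrightarrow> \<Gamma> \<subseteq> \<Delta> \<and> \<not> \<Delta> \<turnstile> Fls \<and> finite (\<Union> (free_vars ` \<Delta>))" for \<Delta>
  define Q where "Q p \<Delta> \<longleftrightarrow> (p \<in> \<Delta> \<or> Neg p \<in> \<Delta>) \<and>
     (\<forall>q. p = All q \<longrightarrow> Neg p \<in> \<Delta> \<longrightarrow> (\<exists>c. Neg (inst c q) \<in> \<Delta>))" for p \<Delta>
  have "\<exists>S. \<forall>n. P (S n) \<and> (S n \<subseteq> S (Suc n) \<and> Q (from_nat n) (S (Suc n)))"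
  proof (rule dependent_nat_choice)
    show "\<exists>\<Delta>. P \<Delta>" using assms by (auto simp: P_def)
  next
    fix \<Delta> n assume "P \<Delta>"
    then show "\<exists>\<Delta>'. P \<Delta>' \<and> (\<Delta> \<subseteq> \<Delta>' \<and> Q (from_nat n) \<Delta>')"
      using henkin_step[of \<Delta> "from_nat n"] unfolding P_def Q_def by (meson subset_trans)
  qed
  then obtain S where P: "\<And>n. P (S n)" and S: "\<And>n. S n \<subseteq> S (Suc n)"
    and Q: "\<And>n. Q (from_nat n) (S (Suc n))" by blast
  define H where "H = (\<Union>n. S n)"
  have mono: "mono S" using S by (simp add: mono_iff_le_Suc)
  have cons: "\<not> H \<turnstile> Fls"
  proof
    assume "H \<turnstile> Fls"
    then obtain \<Delta> where \<Delta>: "\<Delta> \<subseteq> H" "finite \<Delta>" "\<Delta> \<turnstile> Fls" using derives_finite by blast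
    have "\<exists>n. \<Delta> \<subseteq> S n" using \<Delta>(2,1)
    proof (induction rule: finite_induct)
      case (insert q \<Delta>)
      then obtain m n where "\<Delta> \<subseteq> S m" "q \<in> S n" by (auto simp: H_def)
      then have "insert q \<Delta> \<subseteq> S (max m n)"
        using monoD[OF mono, of m "max m n"] monoD[OF mono, of n "max m n"] by auto
      then show ?case ..
    qed simp
    then obtain n where "\<Delta> \<subseteq> S n" ..
    with \<Delta>(3) have "S n \<turnstile> Fls" by (rule derives_mono)
    with P show False by (simp add: P_def)
  qed
  have dec: "p \<in> H \<or> Neg p \<in> H" for p
    using Q[of "to_nat p"] by (auto simp: Q_def H_def)
  have "\<exists>c. Neg (inst c q) \<in> H" if "Neg (All q) \<in> H" for q
  proof -
    let ?n = "to_nat (All q)"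
    \<comment> \<open>\<open>Neg (All q)\<close> may have entered at any stage. As consistency
      excludes \<open>All q\<close>, the stage that decides \<open>All q\<close> also contains its
      negation, and that stage provides the witness.\<close>
    have "All q \<notin> H"
      using that cons derives.Assm derives.ImpE unfolding Neg_def by meson
    then have "Neg (All q) \<in> S (Suc ?n)"
      using Q[of ?n] by (auto simp: Q_def H_def)
    then show ?thesis using Q[of ?n] by (auto simp: Q_def H_def)
  qed
  moreover have "\<Gamma> \<subseteq> H" using P by (auto simp: H_def P_def)
  ultimately show ?thesis using cons dec unfolding henkin_def by (intro exI[of _ H]) simp
qed

section \<open>The term model of a Henkin set\<close>

context
  fixes H assumes H: "henkin H"
begin

lemma henkin_closed: "H \<turnstile> p \<Longrightarrow> p \<in> H"
  using H unfolding henkin_def Neg_def by (meson derives.Assm derives.ImpE)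

lemma henkin_Fls: "Fls \<notin> H"
  using H unfolding henkin_def by (meson derives.Assm)

lemma henkin_Imp: "Imp p q \<in> H \<longleftrightarrow> (p \<in> H \<longrightarrow> q \<in> H)"
proof
  assume "Imp p q \<in> H"
  then show "p \<in> H \<longrightarrow> q \<in> H" by (meson derives.Assm derives.ImpE henkin_closed)
next
  assume a: "p \<in> H \<longrightarrow> q \<in> H"
  have "H \<turnstile> Imp p q"
  proof (cases "q \<in> H")
    case True
    then show ?thesis by (simp add: derives.ImpI derives.Assm)
  next
    case False
    with a H have "Imp p Fls \<in> H" by (auto simp: henkin_def Neg_def)
    then have "insert (Neg q) (insert p H) \<turnstile> Fls"
      using derives.ImpE[OF derives.Assm derives.Assm, of p Fls "insert (Neg q) (insert p H)"] by simp
    then show ?thesis by (rule derives.ImpI[OF derives.Contr])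
  qed
  then show "Imp p q \<in> H" by (rule henkin_closed)
qed

lemma henkin_All: "All p \<in> H \<longleftrightarrow> (\<forall>t. inst t p \<in> H)"
proof
  assume "All p \<in> H"
  then show "\<forall>t. inst t p \<in> H" by (meson derives.Assm derives.AllE henkin_closed)
next
  assume "\<forall>t. inst t p \<in> H"
  then have "Neg (All p) \<notin> H"
    using H henkin_Imp henkin_Fls unfolding henkin_def Neg_def by blast
  then show "All p \<in> H" using H by (auto simp: henkin_def)
qed

lemma henkin_Eq_refl: "Eq t t \<in> H"
  by (rule henkin_closed) (rule derives.EqI)

lemma henkin_Eq_subst: "Eq s t \<in> H \<Longrightarrow> inst s p \<in> H \<Longrightarrow> inst t p \<in> H"
  by (meson derives.Assm derives.EqE henkin_closed)

lemma henkin_Eq_sym: "Eq s t \<in> H \<Longrightarrow> Eq t s \<in> H"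
  using henkin_Eq_subst[of s t "Eq 0 (Suc s)"] henkin_Eq_refl by (simp add: inst_def)

lemma henkin_Eq_trans: "Eq s t \<in> H \<Longrightarrow> Eq t u \<in> H \<Longrightarrow> Eq s u \<in> H"
  using henkin_Eq_subst[of t u "Eq (Suc s) 0"] by (simp add: inst_def)

lemma henkin_Mem_cong: "Eq s s' \<in> H \<Longrightarrow> Eq t t' \<in> H \<Longrightarrow> Mem s t \<in> H \<Longrightarrow> Mem s' t' \<in> H"
  using henkin_Eq_subst[of s s' "Mem 0 (Suc t)"] henkin_Eq_subst[of t t' "Mem (Suc s') 0"]
  by (simp add: inst_def)

text \<open>The map \<open>g\<close> plays the role of the quotient by provable equality. It is left
  abstract so that the quotient can later be realized on \<open>nat\<close>; surjectivity makes
  quantification over the domain the same as quantification over variables.\<close>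

lemma henkin_truth:
  assumes g: "surj g" "\<And>s t. g s = g t \<longleftrightarrow> Eq s t \<in> H"
    and E: "\<And>s t. E (g s) (g t) \<longleftrightarrow> Mem s t \<in> H"
  shows "sat E (\<lambda>x. g (v x)) p \<longleftrightarrow> rename v p \<in> H"
proof (induction p arbitrary: v)
  case (All p)
  have "sat E (\<lambda>x. g (v x)) (All p) \<longleftrightarrow> (\<forall>t. sat E (case_nat (g t) (\<lambda>x. g (v x))) p)"
    using g(1) by (auto, metis surjD)
  also have "\<dots> \<longleftrightarrow> (\<forall>t. sat E (\<lambda>x. g (case_nat t v x)) p)"
    by (intro all_cong1 arg_cong[where f = "\<lambda>v. sat E v p"]) (auto split: nat.split)
  finally show ?case by (simp only: All) (simp add: henkin_All inst_rename_lift)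
qed (auto simp: g E henkin_Imp henkin_Fls)

end

lemma Neg_in_henkin: "henkin H \<Longrightarrow> Neg p \<in> H \<longleftrightarrow> p \<notin> H"
  by (simp add: Neg_def henkin_Imp henkin_Fls)

text \<open>The map taking \<open>x\<close> to its singleton is injective but misses the empty set.\<close>

lemma henkin_ZFC_infinite:
  assumes H: "henkin H" and Z: "{Pairing, Infinity} \<subseteq> H"
    and r: "\<And>s t. r s = r t \<longleftrightarrow> Eq s t \<in> H"
  shows "infinite (range r)"
proof
  assume fin: "finite (range r)"
  note [simp] = henkin_All[OF H] henkin_Imp[OF H] henkin_Fls[OF H] inst_def rename_rename
  have "\<forall>x. \<exists>z. \<forall>w. Mem w z \<in> H \<longleftrightarrow> Eq w x \<in> H"
    using Z by (simp add: Pairing_def UPair_def Iff_def Con_def Dis_def Ex_def Neg_def) blast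
  then obtain sing where sing: "\<And>x w. Mem w (sing x) \<in> H \<longleftrightarrow> Eq w x \<in> H" by metis
  obtain e where e: "\<And>w. Mem w e \<notin> H"
    using Z by (auto simp: Infinity_def Inductive_def Empty_def Con_def Ex_def Neg_def)
  \<comment> \<open>\<open>sing\<close> acts on variables and need not respect classes on the nose,
    so a representative is fixed by \<open>inv_into\<close> before it is applied.\<close>
  have "inj_on (\<lambda>a. r (sing (inv_into UNIV r a))) (range r)"
  proof (rule inj_onI)
    fix a b assume ab: "a \<in> range r" "b \<in> range r" "r (sing (inv_into UNIV r a)) = r (sing (inv_into UNIV r b))"
    then have "Mem (inv_into UNIV r a) (sing (inv_into UNIV r b)) \<in> H"
      using henkin_Mem_cong[OF H henkin_Eq_refl[OF H]] sing henkin_Eq_refl[OF H] r by blast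
    then have "r (inv_into UNIV r a) = r (inv_into UNIV r b)" using sing r by blast
    with ab show "a = b" by (simp add: f_inv_into_f)
  qed
  \<comment> \<open>On a finite set an injective self-map is onto, so the class of the empty
    \<open>e\<close> would be that of a singleton.\<close>
  then have "(\<lambda>a. r (sing (inv_into UNIV r a))) ` range r = range r"
    by (intro endo_inj_surj fin) auto
  then have "r e \<in> (\<lambda>a. r (sing (inv_into UNIV r a))) ` range r" by simp
  then obtain x where "r e = r (sing x)" by blast
  then show False
    using henkin_Mem_cong[OF H henkin_Eq_refl[OF H]] sing henkin_Eq_refl[OF H] r e by metis
qed

section \<open>Completeness for ZFC\<close>

lemma sentence_ZFC: "q \<in> ZFC \<Longrightarrow> sentence q"
  by (auto simp: ZFC_def sentence_def Extensionality_def Foundation_def Pairing_def Union_axiom_def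
      Powerset_def Infinity_def Choice_def UPair_def Subset_def Inductive_def Succ_def Empty_def
      Con_list_def Iff_def Con_def Dis_def Ex_def Neg_def)

text \<open>A Henkin set containing ZFC and the negation of an unprovable \<open>p\<close> yields a
  countermodel. Its domain, the variables modulo equality, is countably infinite and hence a copy of
  \<open>nat\<close>.\<close>

theorem ZFC_complete:
  assumes valid: "\<And>(E :: nat \<Rightarrow> nat \<Rightarrow> bool) v. (\<And>q w. q \<in> ZFC \<Longrightarrow> sat E w q) \<Longrightarrow> sat E v p"
  shows "ZFC \<turnstile> p"
proof (rule ccontr)
  assume "\<not> ZFC \<turnstile> p"
  then have "\<not> insert (Neg p) ZFC \<turnstile> Fls" using derives.Contr by blast
  moreover have "free_vars q = {}" if "q \<in> ZFC" for q
    using sentence_ZFC[OF that] by (simp add: sentence_def)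
  then have "finite (\<Union> (free_vars ` insert (Neg p) ZFC))" by (simp add: finite_free_vars)
  ultimately obtain H where H: "insert (Neg p) ZFC \<subseteq> H" "henkin H"
    using henkin_extension by blast
  \<comment> \<open>The least variable of an equality class serves as its representative.\<close>
  define r where "r t = (LEAST s. Eq s t \<in> H)" for t
  have r: "r s = r t \<longleftrightarrow> Eq s t \<in> H" for s t
  proof
    have rt: "Eq (r t) t \<in> H" for t
      unfolding r_def using henkin_Eq_refl[OF H(2)] by (rule LeastI)
    assume "r s = r t"
    then show "Eq s t \<in> H" using rt henkin_Eq_sym[OF H(2)] henkin_Eq_trans[OF H(2)] by metis
  next
    assume "Eq s t \<in> H"
    then have "Eq u s \<in> H \<longleftrightarrow> Eq u t \<in> H" for u
      using henkin_Eq_sym[OF H(2)] henkin_Eq_trans[OF H(2)] by blast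
    then show "r s = r t" by (simp add: r_def)
  qed
  have inf: "infinite (range r)"
    using H by (intro henkin_ZFC_infinite[OF H(2) _ r]) (auto simp: ZFC_def)
  \<comment> \<open>The infinitely many representatives are numbered without gaps, which makes
    \<open>g\<close> surjective onto \<open>nat\<close>.\<close>
  define g where "g = to_nat_on (range r) \<circ> r"
  have bij: "bij_betw (to_nat_on (range r)) (range r) UNIV"
    using inf by (intro to_nat_on_infinite) auto
  have g: "surj g" "\<And>s t. g s = g t \<longleftrightarrow> Eq s t \<in> H"
    using bij unfolding g_def bij_betw_def image_comp[symmetric] r[symmetric]
    by (simp_all add: inj_on_eq_iff)
  define E where "E a b \<longleftrightarrow> Mem (inv_into UNIV g a) (inv_into UNIV g b) \<in> H" for a b
  have "Eq (inv_into UNIV g (g s)) s \<in> H" for s using g by (metis surj_f_inv_f)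
  then have E: "E (g s) (g t) \<longleftrightarrow> Mem s t \<in> H" for s t
    unfolding E_def using henkin_Mem_cong[OF H(2)] henkin_Eq_sym[OF H(2)] by blast
  note truth = henkin_truth[OF H(2) g, of E, OF E]
  have "sat E w q" if "q \<in> ZFC" for q w
    using truth[of "\<lambda>x. inv_into UNIV g (w x)" q] H(1) that by (auto simp: rename_sentence sentence_ZFC surj_f_inv_f g(1))
  then have "sat E g p" by (rule valid)
  then have "p \<in> H" using truth[of "\<lambda>x. x" p] by (simp add: rename_ident)
  then show False using H Neg_in_henkin by blast
qed

section \<open>Stacking tilings\<close>

definition tile_sum :: "('f \<Rightarrow> 'a \<Rightarrow> 'a \<Rightarrow> bool) \<Rightarrow> 'f set \<Rightarrow> 'a set \<Rightarrow> 'a \<Rightarrow> bool" where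
  "tile_sum Tr F X y \<longleftrightarrow> (\<exists>f\<in>F. \<exists>x\<in>X. Tr f x y)"

text \<open>\<open>Tr f x y\<close> stands for \<open>y = x + f\<close>. The relational form covers both the standard groups and
  the groups that a model of ZFC believes in.\<close>

definition tiles :: "('a \<Rightarrow> bool) \<Rightarrow> ('f \<Rightarrow> 'a \<Rightarrow> 'a \<Rightarrow> bool) \<Rightarrow> nat \<Rightarrow> (nat \<Rightarrow> 'f set) \<Rightarrow>
    ('a \<Rightarrow> bool) \<Rightarrow> (nat \<Rightarrow> 'a set) \<Rightarrow> bool" where
  "tiles Grp Tr J F Tgt X \<longleftrightarrow>
     (\<forall>j\<in>{1..J}. \<forall>x\<in>X j. Grp x) \<and>
     (\<forall>j\<in>{1..J}. \<forall>f\<in>F j. \<forall>f'\<in>F j. \<forall>x\<in>X j. \<forall>x'\<in>X j. \<forall>y.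
        Tr f x y \<longrightarrow> Tr f' x' y \<longrightarrow> f = f' \<and> x = x') \<and>
     (\<forall>i\<in>{1..J}. \<forall>j\<in>{1..J}. i \<noteq> j \<longrightarrow>
        \<not> (\<exists>y. tile_sum Tr (F i) (X i) y \<and> tile_sum Tr (F j) (X j) y)) \<and>
     (\<forall>y. (\<exists>j\<in>{1..J}. tile_sum Tr (F j) (X j) y) \<longleftrightarrow> Tgt y)"

lemma tiles_cong:
  assumes "\<And>j. j \<in> {1..J} \<Longrightarrow> F j = F' j" and "\<And>j. j \<in> {1..J} \<Longrightarrow> X j = X' j"
    and "\<And>y. Tgt y \<longleftrightarrow> Tgt' y"
  shows "tiles Grp Tr J F Tgt X \<longleftrightarrow> tiles Grp Tr J F' Tgt' X'"
  using assms by (simp add: tiles_def)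

text \<open>Here \<open>emb k\<close> places a point in layer \<open>k\<close>,
  \<open>lift m\<close> places a tile element in layer \<open>m\<close>, and \<open>S\<close> holds
  the admissible tile elements. The predicate \<open>P\<close> is the domain on which the embeddings
  are injective: in a model it says "is an ordered pair", which is immediate for both ends of a
  translation and for target points, whereas membership in the group would require further
  arithmetic.\<close>

locale stacking =
  fixes P Grp :: "'a \<Rightarrow> bool" and Tr :: "'f \<Rightarrow> 'a \<Rightarrow> 'a \<Rightarrow> bool" and S :: "'f set"
    and Grp' :: "'b \<Rightarrow> bool" and Tr' :: "'g \<Rightarrow> 'b \<Rightarrow> 'b \<Rightarrow> bool"
    and emb :: "nat \<Rightarrow> 'a \<Rightarrow> 'b" and lift :: "nat \<Rightarrow> 'f \<Rightarrow> 'g" and M N :: nat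
  assumes MN: "M < N"
    and Grp_P: "\<And>x. Grp x \<Longrightarrow> P x"
    and Tr_P: "\<And>f x y. Tr f x y \<Longrightarrow> P x \<and> P y"
    and emb_inj: "\<And>k k' x x'. k < N \<Longrightarrow> k' < N \<Longrightarrow> P x \<Longrightarrow> P x' \<Longrightarrow>
      emb k x = emb k' x' \<Longrightarrow> k = k' \<and> x = x'"
    and Grp'_iff: "\<And>u. Grp' u \<longleftrightarrow> (\<exists>x k. Grp x \<and> k < N \<and> u = emb k x)"
    and Tr'_iff: "\<And>f m u v. f \<in> S \<Longrightarrow> m \<in> {1..M} \<Longrightarrow> Tr' (lift m f) u v \<longleftrightarrow>
      (\<exists>x y k. k < N \<and> Tr f x y \<and> u = emb k x \<and> v = emb ((k + m) mod N) y)"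
    and lift_inj: "\<And>f f' m m'. f \<in> S \<Longrightarrow> f' \<in> S \<Longrightarrow> m \<in> {1..M} \<Longrightarrow> m' \<in> {1..M} \<Longrightarrow>
      lift m f = lift m' f' \<Longrightarrow> m = m' \<and> f = f'"
    and Tr_total: "\<And>f x. Grp x \<Longrightarrow> f \<in> S \<Longrightarrow> \<exists>y. Tr f x y"
begin

text \<open>There is no wraparound from layer 0, because \<open>m <= M < N\<close>.\<close>

lemma Tr'_layer0:
  assumes "f \<in> S" "m \<in> {1..M}" "P x"
  shows "Tr' (lift m f) (emb 0 x) v \<longleftrightarrow> (\<exists>y. Tr f x y \<and> v = emb m y)"
proof
  assume "Tr' (lift m f) (emb 0 x) v"
  then obtain x' y k where "k < N" "Tr f x' y" "emb 0 x = emb k x'" "v = emb ((k + m) mod N) y"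
    using Tr'_iff assms by blast
  moreover from this have "0 = k" "x = x'"
    using emb_inj[of 0 k x x'] assms Tr_P MN by auto
  ultimately show "\<exists>y. Tr f x y \<and> v = emb m y" using assms MN by auto
next
  assume "\<exists>y. Tr f x y \<and> v = emb m y"
  then obtain y where "Tr f x y" "v = emb ((0 + m) mod N) y" using assms MN by auto
  then show "Tr' (lift m f) (emb 0 x) v" using Tr'_iff assms MN
    by (metis bot_nat_0.not_eq_extremum not_less_zero)
qed

context
  fixes J :: nat and F :: "nat \<Rightarrow> nat \<Rightarrow> 'f set" and Tgt :: "nat \<Rightarrow> 'a \<Rightarrow> bool"
  assumes F_S: "\<And>m j. m \<in> {1..M} \<Longrightarrow> j \<in> {1..J} \<Longrightarrow> F m j \<subseteq> S"
    and Tgt_P: "\<And>m y. m \<in> {1..M} \<Longrightarrow> Tgt m y \<Longrightarrow> P y"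
begin

lemma tile_sum_stack:
  assumes j: "j \<in> {1..J}" and X: "\<forall>x\<in>X. P x"
  shows "tile_sum Tr' (\<Union>m\<in>{1..M}. lift m ` F m j) (emb 0 ` X) v \<longleftrightarrow>
    (\<exists>m\<in>{1..M}. \<exists>y. tile_sum Tr (F m j) X y \<and> v = emb m y)"
proof -
  have "tile_sum Tr' (\<Union>m\<in>{1..M}. lift m ` F m j) (emb 0 ` X) v \<longleftrightarrow>
    (\<exists>m\<in>{1..M}. \<exists>f\<in>F m j. \<exists>x\<in>X. Tr' (lift m f) (emb 0 x) v)"
    unfolding tile_sum_def by blast
  also have "\<dots> \<longleftrightarrow> (\<exists>m\<in>{1..M}. \<exists>f\<in>F m j. \<exists>x\<in>X. \<exists>y. Tr f x y \<and> v = emb m y)"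
    using Tr'_layer0 F_S[OF _ j] X by (meson subsetD)
  finally show ?thesis unfolding tile_sum_def by blast
qed

lemma tile_sum_P: "tile_sum Tr F' X y \<Longrightarrow> P y"
  unfolding tile_sum_def using Tr_P by blast

text \<open>Each of the four clauses of \<open>tiles\<close> splits into its layers, since a point
  of the stacked sum determines both its layer and its projection.\<close>

lemma tiles_stack_iff:
  assumes M: "M \<ge> 1" and X: "\<And>j. j \<in> {1..J} \<Longrightarrow> \<forall>x\<in>X j. P x"
  shows "tiles Grp' Tr' J (\<lambda>j. \<Union>m\<in>{1..M}. lift m ` F m j)
      (\<lambda>v. \<exists>m\<in>{1..M}. \<exists>y. Tgt m y \<and> v = emb m y) (\<lambda>j. emb 0 ` X j) \<longleftrightarrow>
    (\<forall>m\<in>{1..M}. tiles Grp Tr J (F m) (Tgt m) X)" (is "?L \<longleftrightarrow> ?R")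
proof -
  let ?F = "\<lambda>j. \<Union>m\<in>{1..M}. lift m ` F m j"
  have sum: "tile_sum Tr' (?F j) (emb 0 ` X j) v \<longleftrightarrow>
    (\<exists>m\<in>{1..M}. \<exists>y. tile_sum Tr (F m j) (X j) y \<and> v = emb m y)" if "j \<in> {1..J}" for j v
    using tile_sum_stack[OF that X[OF that]] .
  have embi: "m = m' \<and> y = y'" if "m \<in> {1..M}" "m' \<in> {1..M}" "P y" "P y'" "emb m y = emb m' y'"
    for m m' y y' using emb_inj[of m m' y y'] that MN by auto
  have sume: "tile_sum Tr' (?F j) (emb 0 ` X j) (emb m y) \<longleftrightarrow> tile_sum Tr (F m j) (X j) y"
    if "j \<in> {1..J}" "m \<in> {1..M}" "P y" for j m y
    unfolding sum[OF that(1)] using embi that tile_sum_P by metis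
  \<comment> \<open>The right-hand side repeats one condition for each \<open>m\<close>, so
    \<open>M >= 1\<close> is what makes it say anything.\<close>
  have 1: "(\<forall>j\<in>{1..J}. \<forall>u\<in>emb 0 ` X j. Grp' u) \<longleftrightarrow> (\<forall>m\<in>{1..M}. \<forall>j\<in>{1..J}. \<forall>x\<in>X j. Grp x)"
  proof -
    have "Grp' (emb 0 x) \<longleftrightarrow> Grp x" if "P x" for x
      using emb_inj[of 0 _ x] that MN Grp_P unfolding Grp'_iff by (metis not_less_zero gr0I)
    then show ?thesis using X M by fastforce
  qed
  have 2: "(\<forall>j\<in>{1..J}. \<forall>f\<in>?F j. \<forall>f'\<in>?F j. \<forall>x\<in>emb 0 ` X j. \<forall>x'\<in>emb 0 ` X j. \<forall>y.
        Tr' f x y \<longrightarrow> Tr' f' x' y \<longrightarrow> f = f' \<and> x = x') \<longleftrightarrow>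
     (\<forall>m\<in>{1..M}. \<forall>j\<in>{1..J}. \<forall>f\<in>F m j. \<forall>f'\<in>F m j. \<forall>x\<in>X j. \<forall>x'\<in>X j. \<forall>y.
        Tr f x y \<longrightarrow> Tr f' x' y \<longrightarrow> f = f' \<and> x = x')" (is "?A \<longleftrightarrow> ?B")
  proof
    assume A: ?A
    show ?B
    proof (intro ballI allI impI)
      fix m j f f' x x' y
      assume a: "m \<in> {1..M}" "j \<in> {1..J}" "f \<in> F m j" "f' \<in> F m j" "x \<in> X j" "x' \<in> X j"
        "Tr f x y" "Tr f' x' y"
      have S: "f \<in> S" "f' \<in> S" and PP: "P x" "P x'" using a F_S X by blast+
      have "Tr' (lift m f) (emb 0 x) (emb m y)" "Tr' (lift m f') (emb 0 x') (emb m y)"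
        using Tr'_layer0 S PP a by blast+
      moreover have "lift m f \<in> ?F j" "lift m f' \<in> ?F j" using a by blast+
      ultimately have "lift m f = lift m f' \<and> emb 0 x = emb 0 x'"
        using A a(2,5,6) by blast
      then show "f = f' \<and> x = x'"
        using lift_inj[of f f' m m] emb_inj[of 0 0 x x'] S PP a MN by simp
    qed
  next
    assume B: ?B
    show ?A
    proof (intro ballI allI impI)
      fix j g g' u u' v
      assume a: "j \<in> {1..J}" "g \<in> ?F j" "g' \<in> ?F j" "u \<in> emb 0 ` X j" "u' \<in> emb 0 ` X j"
        "Tr' g u v" "Tr' g' u' v"
      obtain m f where f: "m \<in> {1..M}" "f \<in> F m j" "g = lift m f" using a(2) by blast
      obtain m' f' where f': "m' \<in> {1..M}" "f' \<in> F m' j" "g' = lift m' f'" using a(3) by blast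
      obtain x x' where x: "x \<in> X j" "u = emb 0 x" "x' \<in> X j" "u' = emb 0 x'" using a(4,5) by blast
      have S: "f \<in> S" "f' \<in> S" and PP: "P x" "P x'" using a(1) f f' x F_S X by blast+
      obtain y where y: "Tr f x y" "v = emb m y"
        using Tr'_layer0[OF S(1) f(1) PP(1)] a(6) f x by blast
      obtain y' where y': "Tr f' x' y'" "v = emb m' y'"
        using Tr'_layer0[OF S(2) f'(1) PP(2)] a(7) f' x by blast
      \<comment> \<open>Coinciding sums lie in the same layer, so both tile elements belong to the
        same equation.\<close>
      have eq: "m' = m" "y' = y"
        using embi[OF f(1) f'(1), of y y'] y y' Tr_P[OF y(1)] Tr_P[OF y'(1)] by auto
      from B[rule_format, OF f(1) a(1) f(2) f'(2)[unfolded eq] x(1,3) y(1) y'(1)[unfolded eq]]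
      show "g = g' \<and> u = u'" using f(3) f'(3) x(2,4) eq by simp
    qed
  qed
  have "(\<exists>v. tile_sum Tr' (?F i) (emb 0 ` X i) v \<and> tile_sum Tr' (?F j) (emb 0 ` X j) v) \<longleftrightarrow>
      (\<exists>m\<in>{1..M}. \<exists>y. tile_sum Tr (F m i) (X i) y \<and> tile_sum Tr (F m j) (X j) y)"
    if ij: "i \<in> {1..J}" "j \<in> {1..J}" for i j
  proof
    assume "\<exists>v. tile_sum Tr' (?F i) (emb 0 ` X i) v \<and> tile_sum Tr' (?F j) (emb 0 ` X j) v"
    then obtain m y where "m \<in> {1..M}" "tile_sum Tr (F m i) (X i) y"
      "tile_sum Tr' (?F j) (emb 0 ` X j) (emb m y)"
      unfolding sum[OF ij(1)] by blast
    then show "\<exists>m\<in>{1..M}. \<exists>y. tile_sum Tr (F m i) (X i) y \<and> tile_sum Tr (F m j) (X j) y"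
      using sume[OF ij(2)] tile_sum_P by blast
  next
    assume "\<exists>m\<in>{1..M}. \<exists>y. tile_sum Tr (F m i) (X i) y \<and> tile_sum Tr (F m j) (X j) y"
    then show "\<exists>v. tile_sum Tr' (?F i) (emb 0 ` X i) v \<and> tile_sum Tr' (?F j) (emb 0 ` X j) v"
      using sum[OF ij(1)] sum[OF ij(2)] by blast
  qed
  then have 3: "(\<forall>i\<in>{1..J}. \<forall>j\<in>{1..J}. i \<noteq> j \<longrightarrow>
      \<not> (\<exists>v. tile_sum Tr' (?F i) (emb 0 ` X i) v \<and> tile_sum Tr' (?F j) (emb 0 ` X j) v)) \<longleftrightarrow>
    (\<forall>m\<in>{1..M}. \<forall>i\<in>{1..J}. \<forall>j\<in>{1..J}. i \<noteq> j \<longrightarrow>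
      \<not> (\<exists>y. tile_sum Tr (F m i) (X i) y \<and> tile_sum Tr (F m j) (X j) y))"
    by blast
  have 4: "(\<forall>v. (\<exists>j\<in>{1..J}. tile_sum Tr' (?F j) (emb 0 ` X j) v) \<longleftrightarrow>
        (\<exists>m\<in>{1..M}. \<exists>y. Tgt m y \<and> v = emb m y)) \<longleftrightarrow>
     (\<forall>m\<in>{1..M}. \<forall>y. (\<exists>j\<in>{1..J}. tile_sum Tr (F m j) (X j) y) \<longleftrightarrow> Tgt m y)" (is "?A \<longleftrightarrow> ?B")
  proof
    assume A: ?A
    show ?B
    proof (intro ballI allI)
      fix m y assume m: "m \<in> {1..M}"
      \<comment> \<open>The conjunct \<open>P y\<close> is carried along because
        \<open>emb m\<close> can only be cancelled on points satisfying \<open>P\<close>.\<close>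
      have "Tgt m y \<longleftrightarrow> P y \<and> (\<exists>m'\<in>{1..M}. \<exists>y'. Tgt m' y' \<and> emb m y = emb m' y')"
        using m Tgt_P embi by metis
      also have "\<dots> \<longleftrightarrow> P y \<and> (\<exists>j\<in>{1..J}. tile_sum Tr' (?F j) (emb 0 ` X j) (emb m y))"
        using A by blast
      also have "\<dots> \<longleftrightarrow> (\<exists>j\<in>{1..J}. tile_sum Tr (F m j) (X j) y)"
        using sume m tile_sum_P by blast
      finally show "(\<exists>j\<in>{1..J}. tile_sum Tr (F m j) (X j) y) \<longleftrightarrow> Tgt m y" ..
    qed
  next
    assume B: ?B
    have "(\<exists>j\<in>{1..J}. tile_sum Tr' (?F j) (emb 0 ` X j) v) \<longleftrightarrow>
        (\<exists>m\<in>{1..M}. \<exists>y. (\<exists>j\<in>{1..J}. tile_sum Tr (F m j) (X j) y) \<and> v = emb m y)" for v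
      using sum[of _ v] by blast
    with B show ?A by simp
  qed
  show ?thesis
    unfolding tiles_def 1 2 3 4 ball_conj_distrib ..
qed

text \<open>A point in a layer \<open>k \<noteq> 0\<close> has a translate outside the layers \<open>1, ..., M\<close>: for \<open>k \<le> M\<close>
  use the layer \<open>M + 1 - k\<close> of the tile, for \<open>k > M\<close> its first layer.\<close>

lemma tiles_layer0:
  assumes ne: "\<And>m j. m \<in> {1..M} \<Longrightarrow> j \<in> {1..J} \<Longrightarrow> F m j \<noteq> {}" and M: "M \<ge> 1"
    and Y: "tiles Grp' Tr' J (\<lambda>j. \<Union>m\<in>{1..M}. lift m ` F m j)
      (\<lambda>v. \<exists>m\<in>{1..M}. \<exists>y. Tgt m y \<and> v = emb m y) Y"
    and j: "j \<in> {1..J}" and u: "u \<in> Y j"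
  shows "\<exists>x. Grp x \<and> u = emb 0 x"
proof -
  have "Grp' u" using Y[unfolded tiles_def, THEN conjunct1] j u by blast
  then obtain x k where x: "Grp x" "k < N" "u = emb k x" unfolding Grp'_iff by blast
  have "k = 0"
  proof (rule ccontr)
    assume k: "k \<noteq> 0"
    define m where "m = (if k \<le> M then M + 1 - k else 1)"
    have m: "m \<in> {1..M}" using k M by (auto simp: m_def)
    \<comment> \<open>In both cases \<open>M < k + m <= N\<close>: the residue is 0 if the sum
      equals \<open>N\<close>, and otherwise it is the sum itself, which exceeds
      \<open>M\<close>.\<close>
    have km: "(k + m) mod N \<notin> {1..M}"
    proof (cases "k + m = N")
      case False
      then have "k + m < N" using k x(2) MN by (auto simp: m_def)
      then show ?thesis by (auto simp: m_def)
    qed simp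
    obtain f where f: "f \<in> F m j" using ne m j by blast
    then have fS: "f \<in> S" using F_S m j by blast
    obtain y where y: "Tr f x y" using Tr_total x(1) fS by blast
    let ?v = "emb ((k + m) mod N) y"
    have "Tr' (lift m f) u ?v" unfolding Tr'_iff[OF fS m] using x y by blast
    then have "tile_sum Tr' (\<Union>m\<in>{1..M}. lift m ` F m j) (Y j) ?v"
      unfolding tile_sum_def using f m u by blast
    then obtain m' y' where m': "m' \<in> {1..M}" "Tgt m' y'" "?v = emb m' y'"
      using Y[unfolded tiles_def, THEN conjunct2, THEN conjunct2, THEN conjunct2, THEN spec, of ?v] j
      by blast
    have "(k + m) mod N < N" "m' < N" using MN m'(1) by auto
    then have "(k + m) mod N = m'" using emb_inj[of _ m' y y'] m' y Tr_P Tgt_P by blast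
    with m' km show False by blast
  qed
  with x show ?thesis by blast
qed

text \<open>The predicates \<open>Q\<close> and \<open>Q'\<close> make one statement serve three
  times: trivial predicates for plain solvability, periodicity for aperiodicity, and
  \<open>definable\<close> for solvability inside a model.\<close>

lemma stacked_solution_iff:
  assumes ne: "\<And>m j. m \<in> {1..M} \<Longrightarrow> j \<in> {1..J} \<Longrightarrow> F m j \<noteq> {}" and M: "M \<ge> 1"
    and Q: "\<And>A. \<forall>x\<in>A. Grp x \<Longrightarrow> Q' (emb 0 ` A) \<longleftrightarrow> Q A"
  shows "(\<exists>Y. tiles Grp' Tr' J (\<lambda>j. \<Union>m\<in>{1..M}. lift m ` F m j)
      (\<lambda>v. \<exists>m\<in>{1..M}. \<exists>y. Tgt m y \<and> v = emb m y) Y \<and> (\<forall>j\<in>{1..J}. Q' (Y j))) \<longleftrightarrow>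
    (\<exists>X. (\<forall>m\<in>{1..M}. tiles Grp Tr J (F m) (Tgt m) X) \<and> (\<forall>j\<in>{1..J}. Q (X j)))"
    (is "(\<exists>Y. ?T Y \<and> _ Y) \<longleftrightarrow> (\<exists>X. ?U X \<and> _ X)")
proof
  assume "\<exists>Y. ?T Y \<and> (\<forall>j\<in>{1..J}. Q' (Y j))"
  then obtain Y where Y: "?T Y" "\<forall>j\<in>{1..J}. Q' (Y j)" by blast
  define X where "X j = {x. Grp x \<and> emb 0 x \<in> Y j}" for j
  have XY: "emb 0 ` X j = Y j" if "j \<in> {1..J}" for j
    using tiles_layer0[OF ne M Y(1) that] by (auto simp: X_def)
  have G: "\<forall>x\<in>X j. Grp x" for j by (simp add: X_def)
  then have P: "\<forall>x\<in>X j. P x" for j using Grp_P by blast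
  have "?T (\<lambda>j. emb 0 ` X j)" using Y(1) XY by (simp add: tiles_def)
  then have "?U X" using tiles_stack_iff[where X = X, OF M P] by blast
  moreover have "\<forall>j\<in>{1..J}. Q (X j)" using Q[OF G] XY Y(2) by metis
  ultimately show "\<exists>X. ?U X \<and> (\<forall>j\<in>{1..J}. Q (X j))" by blast
next
  assume "\<exists>X. ?U X \<and> (\<forall>j\<in>{1..J}. Q (X j))"
  then obtain X where X: "?U X" "\<forall>j\<in>{1..J}. Q (X j)" by blast
  \<comment> \<open>The clause \<open>Grp\<close> is part of every single equation;
    \<open>M >= 1\<close> provides one from which to read it.\<close>
  have "1 \<in> {1..M}" using M by simp
  then have "tiles Grp Tr J (F 1) (Tgt 1) X" using X(1) by blast
  then have G: "\<forall>x\<in>X j. Grp x" if "j \<in> {1..J}" for j using that unfolding tiles_def by blast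
  then have P: "\<forall>x\<in>X j. P x" if "j \<in> {1..J}" for j using that Grp_P by blast
  have "?T (\<lambda>j. emb 0 ` X j)" using X(1) tiles_stack_iff[where X = X, OF M P] by blast
  moreover have "\<forall>j\<in>{1..J}. Q' (emb 0 ` X j)" using Q[OF G] X(2) by blast
  ultimately show "\<exists>Y. ?T Y \<and> (\<forall>j\<in>{1..J}. Q' (Y j))" by (intro exI[of _ "\<lambda>j. emb 0 ` X j"]) simp
qed

end

end

section \<open>Stacking in the standard universe\<close>

text \<open>The cosets \<open>H #> x\<close> are the orbits of left multiplication by
  \<open>H\<close>, so a union of them is exactly an invariant set. In this form periodicity is easy
  to transport along a homomorphism.\<close>

lemma periodic_iff:
  fixes G (structure)
  assumes "group G"
  shows "periodic G A \<longleftrightarrow> A \<subseteq> carrier G \<and> (\<exists>H. subgroup H G \<and> finite (rcosets H) \<and>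
    (\<forall>h\<in>H. \<forall>a\<in>A. h \<otimes> a \<in> A))"
proof -
  interpret group G by fact
  show ?thesis
  proof
    assume "periodic G A"
    then obtain H C where H: "subgroup H G" "finite (rcosets H)" "C \<subseteq> rcosets H" "A = \<Union>C"
      unfolding periodic_def by blast
    interpret H: subgroup H G by fact
    have "h \<otimes> a \<in> A" if ha: "h \<in> H" "a \<in> A" for h a
    proof -
      obtain c where c: "c \<in> C" "a \<in> c" using ha H by blast
      then obtain x where x: "x \<in> carrier G" "c = H #> x" using H(3) by (auto simp: RCOSETS_def)
      then obtain h' where h': "h' \<in> H" "a = h' \<otimes> x" using c by (auto simp: r_coset_def)
      then have "h \<otimes> a = (h \<otimes> h') \<otimes> x" using x ha by (simp add: m_assoc)
      then have "h \<otimes> a \<in> c" using x ha h' by (auto simp: r_coset_def)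
      with c H show ?thesis by blast
    qed
    moreover have "A \<subseteq> carrier G" using H rcosets_part_G[OF H(1)] by blast
    ultimately show "A \<subseteq> carrier G \<and> (\<exists>H. subgroup H G \<and> finite (rcosets H) \<and>
      (\<forall>h\<in>H. \<forall>a\<in>A. h \<otimes> a \<in> A))" using H by blast
  next
    assume "A \<subseteq> carrier G \<and> (\<exists>H. subgroup H G \<and> finite (rcosets H) \<and>
      (\<forall>h\<in>H. \<forall>a\<in>A. h \<otimes> a \<in> A))"
    then obtain H where A: "A \<subseteq> carrier G" and H: "subgroup H G" "finite (rcosets H)"
      "\<And>h a. h \<in> H \<Longrightarrow> a \<in> A \<Longrightarrow> h \<otimes> a \<in> A" by blast
    have "a \<in> H #> a \<and> H #> a \<in> rcosets H \<and> H #> a \<subseteq> A" if "a \<in> A" for a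
    proof -
      have a: "a \<in> carrier G" using that A by blast
      then show ?thesis using rcos_self[OF a H(1)] H(3)[OF _ that]
        by (auto simp: RCOSETS_def r_coset_def)
    qed
    then have "A = \<Union>{c \<in> rcosets H. c \<subseteq> A}" by blast
    with H show "periodic G A" unfolding periodic_def
      by (intro exI[of _ H] exI[of _ "{c \<in> rcosets H. c \<subseteq> A}"]) auto
  qed
qed

text \<open>The set \<open>T\<close> says that the image of \<open>\<phi>\<close> has finite index.
  Finite-index subgroups can then be pulled back along \<open>\<phi>\<close> and pushed forward;
  injectivity recovers the invariance of \<open>A\<close> from that of its image.\<close>

lemma periodic_image_iff:
  assumes G: "group G" and G': "group G'" and \<phi>: "\<phi> \<in> hom G G'" "inj_on \<phi> (carrier G)"
    and T: "finite T" "T \<subseteq> carrier G'"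
      "\<And>u. u \<in> carrier G' \<Longrightarrow> \<exists>x\<in>carrier G. \<exists>t\<in>T. u = \<phi> x \<otimes>\<^bsub>G'\<^esub> t"
    and A: "A \<subseteq> carrier G"
  shows "periodic G' (\<phi> ` A) \<longleftrightarrow> periodic G A"
proof -
  interpret G: group G by fact
  interpret G': group G' by fact
  interpret group_hom G G' \<phi> by (rule group_hom.intro[OF G G' group_hom_axioms.intro[OF \<phi>(1)]])
  show ?thesis
  proof
    assume "periodic G' (\<phi> ` A)"
    then obtain H' where H': "subgroup H' G'" "finite (rcosets\<^bsub>G'\<^esub> H')"
      "\<forall>h\<in>H'. \<forall>u\<in>\<phi> ` A. h \<otimes>\<^bsub>G'\<^esub> u \<in> \<phi> ` A"
      using periodic_iff[OF G', of "\<phi> ` A"] by meson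
    define H where "H = {h \<in> carrier G. \<phi> h \<in> H'}"
    interpret H': subgroup H' G' by fact
    have H: "subgroup H G" by unfold_locales (auto simp: H_def)
    have coset: "H #>\<^bsub>G\<^esub> x = {y \<in> carrier G. \<phi> y \<in> H' #>\<^bsub>G'\<^esub> \<phi> x}" if x: "x \<in> carrier G" for x
    proof (intro equalityI subsetI)
      fix y assume "y \<in> H #>\<^bsub>G\<^esub> x"
      then show "y \<in> {y \<in> carrier G. \<phi> y \<in> H' #>\<^bsub>G'\<^esub> \<phi> x}"
        using x by (auto simp: r_coset_def H_def)
    next
      fix y assume "y \<in> {y \<in> carrier G. \<phi> y \<in> H' #>\<^bsub>G'\<^esub> \<phi> x}"
      then obtain h where y: "y \<in> carrier G" "h \<in> H'" "\<phi> y = h \<otimes>\<^bsub>G'\<^esub> \<phi> x"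
        by (auto simp: r_coset_def)
      then have "\<phi> (y \<otimes>\<^bsub>G\<^esub> inv\<^bsub>G\<^esub> x) = h" using x by (simp add: G'.m_assoc)
      then have "y \<otimes>\<^bsub>G\<^esub> inv\<^bsub>G\<^esub> x \<in> H" using x y by (simp add: H_def)
      moreover have "y = (y \<otimes>\<^bsub>G\<^esub> inv\<^bsub>G\<^esub> x) \<otimes>\<^bsub>G\<^esub> x" using x y by (simp add: G.m_assoc)
      ultimately show "y \<in> H #>\<^bsub>G\<^esub> x" unfolding r_coset_def by blast
    qed
    \<comment> \<open>Cosets of the preimage are preimages of cosets, hence no more
      numerous.\<close>
    have "rcosets\<^bsub>G\<^esub> H \<subseteq> (\<lambda>c. {y \<in> carrier G. \<phi> y \<in> c}) ` (rcosets\<^bsub>G'\<^esub> H')"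
    proof
      fix c assume "c \<in> rcosets\<^bsub>G\<^esub> H"
      then obtain x where x: "x \<in> carrier G" "c = H #>\<^bsub>G\<^esub> x" by (auto simp: RCOSETS_def)
      have "H' #>\<^bsub>G'\<^esub> \<phi> x \<in> rcosets\<^bsub>G'\<^esub> H'" using x by (auto simp: RCOSETS_def)
      then show "c \<in> (\<lambda>c. {y \<in> carrier G. \<phi> y \<in> c}) ` (rcosets\<^bsub>G'\<^esub> H')"
        unfolding x(2) coset[OF x(1)] by (rule imageI)
    qed
    then have "finite (rcosets\<^bsub>G\<^esub> H)" using H'(2) finite_surj by blast
    moreover have "h \<otimes>\<^bsub>G\<^esub> a \<in> A" if ha: "h \<in> H" "a \<in> A" for h a
    proof -
      have "\<phi> (h \<otimes>\<^bsub>G\<^esub> a) \<in> \<phi> ` A" using H'(3)[rule_format, of "\<phi> h" "\<phi> a"] ha A by (auto simp: H_def)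
      then show ?thesis using ha A inj_on_image_mem_iff[OF \<phi>(2) _ A] by (auto simp: H_def)
    qed
    ultimately show "periodic G A" using periodic_iff[OF G, of A] A H by meson
  next
    assume "periodic G A"
    then obtain H where H: "subgroup H G" "finite (rcosets\<^bsub>G\<^esub> H)"
      "\<forall>h\<in>H. \<forall>a\<in>A. h \<otimes>\<^bsub>G\<^esub> a \<in> A"
      using periodic_iff[OF G, of A] by meson
    interpret H: subgroup H G by fact
    have H': "subgroup (\<phi> ` H) G'" using H(1) by (rule subgroup_img_is_subgroup)
    have coset: "\<phi> ` H #>\<^bsub>G'\<^esub> (\<phi> x \<otimes>\<^bsub>G'\<^esub> t) = \<phi> ` (H #>\<^bsub>G\<^esub> x) #>\<^bsub>G'\<^esub> t"
      if "x \<in> carrier G" "t \<in> T" for x t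
      using that T(2) by (force simp: r_coset_def G'.m_assoc subset_iff)
    \<comment> \<open>Splitting a representative as an image times an element of \<open>T\<close>
      exhibits each coset as one of finitely many translates.\<close>
    have "rcosets\<^bsub>G'\<^esub> (\<phi> ` H) \<subseteq> (\<lambda>(t, c). \<phi> ` c #>\<^bsub>G'\<^esub> t) ` (T \<times> rcosets\<^bsub>G\<^esub> H)"
    proof
      fix c assume "c \<in> rcosets\<^bsub>G'\<^esub> (\<phi> ` H)"
      then obtain u where u: "u \<in> carrier G'" "c = \<phi> ` H #>\<^bsub>G'\<^esub> u" by (auto simp: RCOSETS_def)
      then obtain x t where x: "x \<in> carrier G" "t \<in> T" "u = \<phi> x \<otimes>\<^bsub>G'\<^esub> t" using T(3) by blast
      have "(t, H #>\<^bsub>G\<^esub> x) \<in> T \<times> rcosets\<^bsub>G\<^esub> H" using x by (auto simp: RCOSETS_def)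
      moreover have "c = (\<lambda>(t, c). \<phi> ` c #>\<^bsub>G'\<^esub> t) (t, H #>\<^bsub>G\<^esub> x)"
        using u x coset by simp
      ultimately show "c \<in> (\<lambda>(t, c). \<phi> ` c #>\<^bsub>G'\<^esub> t) ` (T \<times> rcosets\<^bsub>G\<^esub> H)"
        by (rule rev_image_eqI)
    qed
    then have "finite (rcosets\<^bsub>G'\<^esub> (\<phi> ` H))"
      using T(1) H(2) finite_surj[of "T \<times> rcosets\<^bsub>G\<^esub> H"] by blast
    moreover have "h \<otimes>\<^bsub>G'\<^esub> u \<in> \<phi> ` A" if hu: "h \<in> \<phi> ` H" "u \<in> \<phi> ` A" for h u
    proof -
      obtain h' a where "h' \<in> H" "h = \<phi> h'" "a \<in> A" "u = \<phi> a" using hu by blast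
      moreover from this have "h \<otimes>\<^bsub>G'\<^esub> u = \<phi> (h' \<otimes>\<^bsub>G\<^esub> a)" using A by (simp add: subset_iff)
      ultimately show ?thesis using H(3) by blast
    qed
    moreover have "\<phi> ` A \<subseteq> carrier G'" using A by auto
    ultimately show "periodic G' (\<phi> ` A)" using periodic_iff[OF G', of "\<phi> ` A"] H' by meson
  qed
qed

section \<open>Explicit groups as an instance of stacking\<close>

text \<open>Multiplication in HOL is a total function, also off the carrier; the carrier conditions
  restrict the relation to genuine group elements.\<close>

definition shift_rel :: "('a, 'b) monoid_scheme \<Rightarrow> 'a \<Rightarrow> 'a \<Rightarrow> 'a \<Rightarrow> bool" where
  "shift_rel G f x y \<longleftrightarrow> f \<in> carrier G \<and> x \<in> carrier G \<and> y = x \<otimes>\<^bsub>G\<^esub> f"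

lemma solves_tile_iff_tiles:
  assumes F: "\<And>j. j \<in> {1..J} \<Longrightarrow> F j \<subseteq> carrier G"
  shows "solves_tile G J F E X \<longleftrightarrow>
    tiles (\<lambda>x. x \<in> carrier G) (shift_rel G) J F (\<lambda>y. y \<in> E) X"
proof (cases "\<forall>j\<in>{1..J}. X j \<subseteq> carrier G")
  case False
  then show ?thesis unfolding solves_tile_def tiles_def by blast
next
  case X: True
  have sum: "y \<in> X j <#>\<^bsub>G\<^esub> F j \<longleftrightarrow> tile_sum (shift_rel G) (F j) (X j) y" if "j \<in> {1..J}" for j y
    using F[OF that] X[rule_format, OF that]
    unfolding set_mult_def tile_sum_def shift_rel_def by blast
  have d: "direct_sum_defined G (X j) (F j) \<longleftrightarrow> (\<forall>f\<in>F j. \<forall>f'\<in>F j. \<forall>x\<in>X j. \<forall>x'\<in>X j. \<forall>y.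
        shift_rel G f x y \<longrightarrow> shift_rel G f' x' y \<longrightarrow> f = f' \<and> x = x')" if "j \<in> {1..J}" for j
    using F[OF that] X[rule_format, OF that]
    unfolding direct_sum_defined_def inj_on_def shift_rel_def
    by (auto simp: subset_iff)
  have e: "disjoint_family_on (\<lambda>j. X j <#>\<^bsub>G\<^esub> F j) {1..J} \<longleftrightarrow>
     (\<forall>i\<in>{1..J}. \<forall>j\<in>{1..J}. i \<noteq> j \<longrightarrow>
        \<not> (\<exists>y. tile_sum (shift_rel G) (F i) (X i) y \<and> tile_sum (shift_rel G) (F j) (X j) y))"
    unfolding disjoint_family_on_def using sum by (simp add: disjoint_iff)
  have t: "(\<Union>j\<in>{1..J}. X j <#>\<^bsub>G\<^esub> F j) = E \<longleftrightarrow>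
     (\<forall>y. (\<exists>j\<in>{1..J}. tile_sum (shift_rel G) (F j) (X j) y) \<longleftrightarrow> y \<in> E)"
    unfolding set_eq_iff using sum by simp
  have a: "(\<forall>j\<in>{1..J}. X j \<subseteq> carrier G) \<longleftrightarrow> (\<forall>j\<in>{1..J}. \<forall>x\<in>X j. x \<in> carrier G)"
    by (simp only: subset_eq)
  show ?thesis unfolding solves_tile_def tiles_def a e t by (simp only: d cong: ball_cong)
qed

lemma group_explicit_finite_group: "group (explicit_finite_group Ns)"
  by (simp add: explicit_finite_group_def)

lemma group_explicit_group: "group (explicit_group d Ns)"
  unfolding explicit_group_def int_power_group_def
  by (intro DirProd_group group_explicit_finite_group product_group) simp

lemma append_residue_in_carrier:
  assumes N: "N > 0" and a: "a \<in> carrier (explicit_finite_group Ns)"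
  shows "append_residue Ns N a k \<in> carrier (explicit_finite_group (Ns @ [N]))"
proof -
  have "append_residue Ns N a k i \<in> carrier (integer_mod_group ((Ns @ [N]) ! i))"
    if "i < Suc (length Ns)" for i
  proof (cases "i < length Ns")
    case True
    then show ?thesis
      using a by (auto simp: explicit_finite_group_def append_residue_def PiE_iff nth_append)
  next
    case False
    with that N show ?thesis
      by (simp add: append_residue_def nth_append less_Suc_eq carrier_integer_mod_group)
  qed
  then show ?thesis
    using a by (auto simp: explicit_finite_group_def append_residue_def PiE_iff extensional_def)
qed

lemma carrier_explicit_finite_group_append:
  assumes "N > 0"
  shows "b \<in> carrier (explicit_finite_group (Ns @ [N])) \<longleftrightarrow>
    (\<exists>a k. a \<in> carrier (explicit_finite_group Ns) \<and> k < N \<and> b = append_residue Ns N a k)"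
proof
  assume b: "b \<in> carrier (explicit_finite_group (Ns @ [N]))"
  \<comment> \<open>Elements of a product group are extensional functions, so dropping the last
    coordinate means resetting it to \<open>undefined\<close>.\<close>
  define a where "a = b(length Ns := undefined)"
  have bi: "b i \<in> carrier (integer_mod_group ((Ns @ [N]) ! i))" if "i < Suc (length Ns)" for i
    using b that by (auto simp: explicit_finite_group_def PiE_iff)
  have bN: "0 \<le> b (length Ns)" "b (length Ns) < int N"
    using bi[of "length Ns"] assms by (simp_all add: carrier_integer_mod_group)
  have "b i \<in> carrier (integer_mod_group (Ns ! i))" if "i < length Ns" for i
    using bi[of i] that by (simp add: nth_append)
  then have "a \<in> carrier (explicit_finite_group Ns)"
    using b by (auto simp: a_def explicit_finite_group_def PiE_iff extensional_def)
  moreover have "nat (b (length Ns)) < N" "b = append_residue Ns N a (nat (b (length Ns)))"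
    using bN by (auto simp: a_def append_residue_def)
  ultimately show "\<exists>a k. a \<in> carrier (explicit_finite_group Ns) \<and> k < N \<and> b = append_residue Ns N a k"
    by blast
qed (use append_residue_in_carrier assms in blast)

lemma append_residue_mult:
  assumes "N > 0" "a \<in> carrier (explicit_finite_group Ns)" "b \<in> carrier (explicit_finite_group Ns)"
  shows "append_residue Ns N a k \<otimes>\<^bsub>explicit_finite_group (Ns @ [N])\<^esub> append_residue Ns N b m =
    append_residue Ns N (a \<otimes>\<^bsub>explicit_finite_group Ns\<^esub> b) ((k + m) mod N)"
  by (auto simp: explicit_finite_group_def append_residue_def fun_eq_iff restrict_def
      nth_append less_Suc_eq mod_simps zmod_int)

lemma append_residue_inj:
  assumes "a \<in> carrier (explicit_finite_group Ns)" "b \<in> carrier (explicit_finite_group Ns)"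
    "k < N" "m < N" "append_residue Ns N a k = append_residue Ns N b m"
  shows "k = m \<and> a = b"
proof -
  have e: "(a(length Ns := int k mod int N)) i = (b(length Ns := int m mod int N)) i" for i
    using assms(5) by (simp add: append_residue_def)
  from e[of "length Ns"] have "k = m" using assms by simp
  moreover have "a i = b i" for i
  \<comment> \<open>At the new index the two original functions are both \<open>undefined\<close>,
    which the updated functions no longer show.\<close>
  proof (cases "i = length Ns")
    case True
    then show ?thesis
      using assms(1,2) by (auto simp: explicit_finite_group_def PiE_iff extensional_def)
  next
    case False
    then show ?thesis using e[of i] by simp
  qed
  ultimately show ?thesis by auto
qed

text \<open>In the standard group this map serves both as \<open>emb\<close> and as
  \<open>lift\<close>; in a model it is only the lift, since tile elements stay outside the
  model.\<close>

definition layer :: "nat list \<Rightarrow> nat \<Rightarrow> nat \<Rightarrow> elem \<Rightarrow> elem" where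
  "layer Ns N m = (\<lambda>(z, a). (z, append_residue Ns N a m))"

lemma layer_mult:
  assumes "N > 0" "x \<in> carrier (explicit_group d Ns)" "y \<in> carrier (explicit_group d Ns)"
  shows "layer Ns N k x \<otimes>\<^bsub>explicit_group d (Ns @ [N])\<^esub> layer Ns N m y =
    layer Ns N ((k + m) mod N) (x \<otimes>\<^bsub>explicit_group d Ns\<^esub> y)"
  using assms by (auto simp: layer_def explicit_group_def append_residue_mult)

lemma carrier_explicit_group_append:
  assumes "N > 0"
  shows "u \<in> carrier (explicit_group d (Ns @ [N])) \<longleftrightarrow>
    (\<exists>x k. x \<in> carrier (explicit_group d Ns) \<and> k < N \<and> u = layer Ns N k x)"
  by (cases u) (auto simp: layer_def explicit_group_def
      carrier_explicit_finite_group_append[OF assms])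

lemma layer_inj:
  assumes "x \<in> carrier (explicit_group d Ns)" "y \<in> carrier (explicit_group d Ns)"
    "k < N" "m < N" "layer Ns N k x = layer Ns N m y"
  shows "k = m \<and> x = y"
  using assms append_residue_inj[of "snd x" Ns "snd y" k N m]
  by (auto simp: layer_def explicit_group_def split: prod.splits)

lemma stacking_explicit_group:
  assumes "M < N"
  shows "stacking (\<lambda>x. x \<in> carrier (explicit_group d Ns)) (\<lambda>x. x \<in> carrier (explicit_group d Ns))
    (shift_rel (explicit_group d Ns)) (carrier (explicit_group d Ns))
    (\<lambda>x. x \<in> carrier (explicit_group d (Ns @ [N]))) (shift_rel (explicit_group d (Ns @ [N])))
    (layer Ns N) (layer Ns N) M N"
proof -
  let ?G = "explicit_group d Ns" and ?G' = "explicit_group d (Ns @ [N])"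
  have N: "N > 0" using assms by simp
  interpret G: group ?G by (rule group_explicit_group)
  show ?thesis
  proof
    fix f m u v assume f: "f \<in> carrier ?G" and m: "m \<in> {1..M}"
    have "m < N" using m assms by simp
    then have "layer Ns N m f \<in> carrier ?G'"
      unfolding carrier_explicit_group_append[OF N] using f by blast
    then have "shift_rel ?G' (layer Ns N m f) u v \<longleftrightarrow>
      (\<exists>x k. x \<in> carrier ?G \<and> k < N \<and> u = layer Ns N k x \<and> v = u \<otimes>\<^bsub>?G'\<^esub> layer Ns N m f)"
      unfolding shift_rel_def carrier_explicit_group_append[OF N] by blast
    also have "\<dots> \<longleftrightarrow> (\<exists>x k. x \<in> carrier ?G \<and> k < N \<and> u = layer Ns N k x \<and>
        v = layer Ns N ((k + m) mod N) (x \<otimes>\<^bsub>?G\<^esub> f))"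
      using layer_mult[OF N _ f] by metis
    finally show "shift_rel ?G' (layer Ns N m f) u v \<longleftrightarrow> (\<exists>x y k. k < N \<and> shift_rel ?G f x y \<and>
        u = layer Ns N k x \<and> v = layer Ns N ((k + m) mod N) y)"
      using f unfolding shift_rel_def by blast
  next
    fix f f' m m' assume f: "f \<in> carrier ?G" "f' \<in> carrier ?G" and m: "m \<in> {1..M}" "m' \<in> {1..M}"
      and e: "layer Ns N m f = layer Ns N m' f'"
    have "m < N" "m' < N" using m assms by auto
    from layer_inj[OF f this e] show "m = m' \<and> f = f'" .
  next
    fix u show "u \<in> carrier ?G' \<longleftrightarrow> (\<exists>x k. x \<in> carrier ?G \<and> k < N \<and> u = layer Ns N k x)"
      by (rule carrier_explicit_group_append[OF N])
  next
    fix k k' x x'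
    assume "k < N" "k' < N" "x \<in> carrier ?G" "x' \<in> carrier ?G" "layer Ns N k x = layer Ns N k' x'"
    then show "k = k' \<and> x = x'" by (intro layer_inj)
  next
    fix f x y assume "shift_rel ?G f x y"
    then show "x \<in> carrier ?G \<and> y \<in> carrier ?G" unfolding shift_rel_def by simp
  next
    fix f x assume "x \<in> carrier ?G" "f \<in> carrier ?G"
    then show "\<exists>y. shift_rel ?G f x y" unfolding shift_rel_def by blast
  qed (rule assms)
qed

lemma periodic_layer_iff:
  assumes N: "N > 0" and A: "A \<subseteq> carrier (explicit_group d Ns)"
  shows "periodic (explicit_group d (Ns @ [N])) (layer Ns N 0 ` A) \<longleftrightarrow>
    periodic (explicit_group d Ns) A"
proof (rule periodic_image_iff[OF group_explicit_group group_explicit_group])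
  let ?G = "explicit_group d Ns" and ?G' = "explicit_group d (Ns @ [N])"
  \<comment> \<open>One element over the identity in each of the \<open>N\<close> layers: together
    they represent all cosets of layer 0.\<close>
  let ?T = "(\<lambda>k. layer Ns N k \<one>\<^bsub>?G\<^esub>) ` {..<N}"
  interpret G: group ?G by (rule group_explicit_group)
  have c: "layer Ns N k x \<in> carrier ?G'" if "x \<in> carrier ?G" "k < N" for x k
    unfolding carrier_explicit_group_append[OF N] using that by blast
  show "layer Ns N 0 \<in> hom ?G ?G'" using c N by (auto simp: hom_def layer_mult)
  show "inj_on (layer Ns N 0) (carrier ?G)" using layer_inj N by (meson inj_onI)
  show "finite ?T" by simp
  show "?T \<subseteq> carrier ?G'" using c by blast
  fix u assume "u \<in> carrier ?G'"
  then obtain x k where x: "x \<in> carrier ?G" "k < N" "u = layer Ns N k x"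
    using carrier_explicit_group_append[OF N] by blast
  then have "u = layer Ns N 0 x \<otimes>\<^bsub>?G'\<^esub> layer Ns N k \<one>\<^bsub>?G\<^esub>" using N by (simp add: layer_mult)
  with x show "\<exists>x\<in>carrier ?G. \<exists>t\<in>?T. u = layer Ns N 0 x \<otimes>\<^bsub>?G'\<^esub> t" by blast
qed (rule A)

text \<open>Aperiodicity combines two existence statements, and each is an instance of
  \<open>stacked_solution_iff\<close>, without a side condition and with periodicity.\<close>

theorem aperiodic_stacked_iff:
  assumes M: "M \<ge> 1" "N > M"
    and F: "\<And>m j. m \<in> {1..M} \<Longrightarrow> j \<in> {1..J} \<Longrightarrow>
      F m j \<noteq> {} \<and> F m j \<subseteq> carrier (explicit_group d Ns)"
    and E0: "\<And>m. m \<in> {1..M} \<Longrightarrow> E0 m \<subseteq> carrier (explicit_finite_group Ns)"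
  shows "aperiodic_tile d (Ns @ [N]) J (stacked_tile Ns N M F) (stacked_set Ns N M E0) \<longleftrightarrow>
    aperiodic_system d Ns J M F E0"
proof -
  let ?G = "explicit_group d Ns" and ?G' = "explicit_group d (Ns @ [N])"
  let ?F = "\<lambda>j. \<Union>m\<in>{1..M}. layer Ns N m ` F m j"
  let ?Tgt = "\<lambda>m y. y \<in> carrier (int_power_group d) \<times> E0 m"
  have N: "N > 0" using M by simp
  interpret stacking "\<lambda>x. x \<in> carrier ?G" "\<lambda>x. x \<in> carrier ?G" "shift_rel ?G" "carrier ?G"
    "\<lambda>x. x \<in> carrier ?G'" "shift_rel ?G'" "layer Ns N" "layer Ns N" M N
    using M(2) by (rule stacking_explicit_group)
  have F': "stacked_tile Ns N M F = ?F" by (auto simp: fun_eq_iff stacked_tile_def layer_def)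
  have "layer Ns N m f \<in> carrier ?G'" if "m \<in> {1..M}" "j \<in> {1..J}" "f \<in> F m j" for m j f
  proof -
    have "m < N" "f \<in> carrier ?G" using that F[OF that(1,2)] M by auto
    then show ?thesis unfolding carrier_explicit_group_append[OF N] by blast
  qed
  then have FG: "?F j \<subseteq> carrier ?G'" if "j \<in> {1..J}" for j using that by blast
  have T: "y \<in> carrier (int_power_group d) \<times> stacked_set Ns N M E0 \<longleftrightarrow>
      (\<exists>m\<in>{1..M}. \<exists>x. ?Tgt m x \<and> y = layer Ns N m x)" for y
    by (cases y) (auto simp: stacked_set_def layer_def)
  have tile: "solves_system d (Ns @ [N]) J 1 (\<lambda>_. stacked_tile Ns N M F) (\<lambda>_. stacked_set Ns N M E0) Y
    \<longleftrightarrow> tiles (\<lambda>x. x \<in> carrier ?G') (shift_rel ?G') J ?F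
      (\<lambda>v. \<exists>m\<in>{1..M}. \<exists>y. ?Tgt m y \<and> v = layer Ns N m y) Y" for Y
    unfolding solves_system_def F' using solves_tile_iff_tiles[of J ?F ?G', OF FG] T by simp
  have sys: "solves_system d Ns J M F E0 X \<longleftrightarrow> (\<forall>m\<in>{1..M}.
      tiles (\<lambda>x. x \<in> carrier ?G) (shift_rel ?G) J (F m) (?Tgt m) X)" for X
    unfolding solves_system_def using F by (intro ball_cong refl solves_tile_iff_tiles) blast
  have TP: "y \<in> carrier ?G" if "m \<in> {1..M}" "?Tgt m y" for m y
    using that E0 by (auto simp: explicit_group_def)
  note iff = stacked_solution_iff[where J = J and F = F and Tgt = ?Tgt, OF _ TP _ M(1)]
  have "(\<exists>Y. solves_system d (Ns @ [N]) J 1 (\<lambda>_. stacked_tile Ns N M F) (\<lambda>_. stacked_set Ns N M E0) Y)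
    \<longleftrightarrow> (\<exists>X. solves_system d Ns J M F E0 X)"
    using iff[where Q = "\<lambda>_. True" and Q' = "\<lambda>_. True"] F unfolding tile sys by simp
  moreover have "(\<exists>Y. solves_system d (Ns @ [N]) J 1 (\<lambda>_. stacked_tile Ns N M F)
        (\<lambda>_. stacked_set Ns N M E0) Y \<and> (\<forall>j\<in>{1..J}. periodic ?G' (Y j)))
    \<longleftrightarrow> (\<exists>X. solves_system d Ns J M F E0 X \<and> (\<forall>j\<in>{1..J}. periodic ?G (X j)))"
    unfolding tile sys by (rule iff) (use F periodic_layer_iff[OF N] in \<open>auto simp: subset_iff\<close>)
  ultimately show ?thesis unfolding aperiodic_tile_def aperiodic_system_def by blast
qed

section \<open>Tilings inside a model of ZFC\<close>

lemma sat_connectives [simp]: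
  "sat E v (Neg p) \<longleftrightarrow> \<not> sat E v p"
  "sat E v (Dis p q) \<longleftrightarrow> sat E v p \<or> sat E v q"
  "sat E v (Con p q) \<longleftrightarrow> sat E v p \<and> sat E v q"
  "sat E v (Iff p q) \<longleftrightarrow> (sat E v p \<longleftrightarrow> sat E v q)"
  "sat E v (Ex p) \<longleftrightarrow> (\<exists>a. sat E (case_nat a v) p)"
  by (auto simp: Neg_def Dis_def Con_def Iff_def Ex_def)

lemma sat_Con_list [simp]: "sat E v (Con_list ps) \<longleftrightarrow> (\<forall>p\<in>set ps. sat E v p)"
  unfolding Con_list_def by (induction ps) auto

lemma sat_Dis_list [simp]: "sat E v (Dis_list ps) \<longleftrightarrow> (\<exists>p\<in>set ps. sat E v p)"
  unfolding Dis_list_def by (induction ps) auto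

lemma ball_set_distinct_pairs:
  "(\<forall>p\<in>set [g i j. i \<leftarrow> xs, j \<leftarrow> ys, i \<noteq> j]. P p) \<longleftrightarrow>
     (\<forall>i\<in>set xs. \<forall>j\<in>set ys. i \<noteq> j \<longrightarrow> P (g i j))"
proof -
  have "set [g i j. i \<leftarrow> xs, j \<leftarrow> ys, i \<noteq> j] =
      (\<Union>i\<in>set xs. \<Union>j\<in>set ys. if i \<noteq> j then {g i j} else {})"
    by (simp add: if_distrib[of set])
  then show ?thesis by auto
qed

lemma set_some_enumeration: "finite A \<Longrightarrow> set (SOME xs. set xs = A) = A"
  by (rule someI_ex) (rule finite_list)

lemma sat_Con_over [simp]: "finite A \<Longrightarrow> sat E v (Con_over A p) \<longleftrightarrow> (\<forall>a\<in>A. sat E v (p a))"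
  by (simp add: Con_over_def set_some_enumeration)

lemma sat_Dis_over [simp]: "finite A \<Longrightarrow> sat E v (Dis_over A p) \<longleftrightarrow> (\<exists>a\<in>A. sat E v (p a))"
  by (simp add: Dis_over_def set_some_enumeration)

text \<open>A block of \<open>n\<close> quantifiers fills the indices below \<open>n\<close> and
  shifts the old valuation by \<open>n\<close>; so a single \<open>w\<close> holds all the unknowns,
  the \<open>j\<close>-th one at index \<open>j - 1\<close>.\<close>

lemma sat_Ex_power: "sat E v ((Ex ^^ n) p) \<longleftrightarrow> (\<exists>w. (\<forall>i. w (i + n) = v i) \<and> sat E w p)"
proof (induction n arbitrary: v)
  case 0
  have "(\<forall>i. w i = v i) \<longleftrightarrow> w = v" for w by auto
  then show ?case by simp
next
  case (Suc n)
  have "(\<exists>a. \<forall>i. w (i + n) = case_nat a v i) \<longleftrightarrow> (\<forall>i. w (Suc (i + n)) = v i)" for w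
  proof
    assume "\<exists>a. \<forall>i. w (i + n) = case_nat a v i"
    then obtain a where a: "w (i + n) = case_nat a v i" for i by blast
    show "\<forall>i. w (Suc (i + n)) = v i" using a[of "Suc i" for i] by simp
  next
    assume "\<forall>i. w (Suc (i + n)) = v i"
    then have "\<forall>i. w (i + n) = case_nat (w n) v i" by (auto split: nat.split)
    then show "\<exists>a. \<forall>i. w (i + n) = case_nat a v i" ..
  qed
  then show ?case by (simp add: Suc.IH) metis
qed

lemma sat_All_power: "(\<And>v. sat E v ((All ^^ n) p)) \<Longrightarrow> sat E v p"
proof (induction n arbitrary: v)
  case (Suc n)
  have "sat E u ((All ^^ n) p)" for u
  proof -
    have "case_nat (u 0) (\<lambda>i. u (Suc i)) = u" by (auto simp: fun_eq_iff split: nat.split)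
    with Suc.prems[of "\<lambda>i. u (Suc i)"] show ?thesis by (auto dest: spec[of _ "u 0"])
  qed
  then show ?case by (rule Suc.IH)
qed simp

text \<open>Every formula has a closure among the axioms of a scheme; with
  \<open>sat_All_power\<close> the scheme becomes available for arbitrary parameters.\<close>

lemma sentence_All_power: "\<exists>n. sentence ((All ^^ n) p)"
proof -
  have fv: "free_vars ((All ^^ n) p) = {x. x + n \<in> free_vars p}" for n
    by (induction n) auto
  obtain n where "\<forall>x\<in>free_vars p. x < n" using finite_nat_set_iff_bounded finite_free_vars by blast
  then have "free_vars ((All ^^ n) p) = {}" unfolding fv by fastforce
  then show ?thesis unfolding sentence_def by blast
qed

section \<open>Elementary set theory in a model\<close>

locale zfc_model =
  fixes mem :: "'a \<Rightarrow> 'a \<Rightarrow> bool" (infix "\<epsilon>" 50)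
  assumes sat_ZFC: "q \<in> ZFC \<Longrightarrow> sat (\<epsilon>) v q"
begin

lemma extensionality: "(\<And>z. z \<epsilon> x \<longleftrightarrow> z \<epsilon> y) \<Longrightarrow> x = y"
  using sat_ZFC[of Extensionality] by (simp add: ZFC_def Extensionality_def numeral_2_eq_2)

text \<open>Foundation applied to the singleton of \<open>x\<close>.\<close>

lemma not_mem_self: "\<not> x \<epsilon> x"
proof
  assume x: "x \<epsilon> x"
  have "\<forall>x y. \<exists>s. \<forall>w. w \<epsilon> s \<longleftrightarrow> w = x \<or> w = y"
    using sat_ZFC[of Pairing] by (simp add: ZFC_def Pairing_def UPair_def numeral_eq_Suc)
  then obtain s where s: "\<And>w. w \<epsilon> s \<longleftrightarrow> w = x" by metis
  have "\<forall>a. (\<exists>x. x \<epsilon> a) \<longrightarrow> (\<exists>x. x \<epsilon> a \<and> \<not> (\<exists>z. z \<epsilon> a \<and> z \<epsilon> x))"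
    using sat_ZFC[of Foundation] by (simp add: ZFC_def Foundation_def numeral_eq_Suc)
  with s x show False by metis
qed

lemma separation: "\<exists>b. \<forall>x. x \<epsilon> b \<longleftrightarrow> x \<epsilon> a \<and> sat (\<epsilon>) (case_nat x (case_nat a v)) p"
proof -
  obtain n where "sentence ((All ^^ n) (Separation p))" using sentence_All_power by blast
  then have "(All ^^ n) (Separation p) \<in> ZFC" unfolding ZFC_def by blast
  then have "sat (\<epsilon>) u (Separation p)" for u by (rule sat_All_power[OF sat_ZFC])
  then have "sat (\<epsilon>) v (Separation p)" .
  \<comment> \<open>The renaming in the scheme merely steps over the quantified set
    \<open>b\<close>.\<close>
  moreover have "(\<lambda>i. case_nat x (case_nat b w) (case_nat 0 (\<lambda>i. Suc (Suc i)) i)) = case_nat x w"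
    for x b and w :: "nat \<Rightarrow> 'a"
    by (auto simp: fun_eq_iff split: nat.split)
  ultimately show ?thesis by (simp add: Separation_def sat_rename numeral_2_eq_2)
qed

lemma replacement:
  assumes "\<And>x y y'. x \<epsilon> a \<Longrightarrow> sat (\<epsilon>) (case_nat y (case_nat x (case_nat a v))) p \<Longrightarrow>
    sat (\<epsilon>) (case_nat y' (case_nat x (case_nat a v))) p \<Longrightarrow> y = y'"
  shows "\<exists>b. \<forall>y. y \<epsilon> b \<longleftrightarrow> (\<exists>x. x \<epsilon> a \<and> sat (\<epsilon>) (case_nat y (case_nat x (case_nat a v))) p)"
proof -
  obtain n where "sentence ((All ^^ n) (Replacement p))" using sentence_All_power by blast
  then have "(All ^^ n) (Replacement p) \<in> ZFC" unfolding ZFC_def by blast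
  then have s: "sat (\<epsilon>) u (Replacement p)" for u by (rule sat_All_power[OF sat_ZFC])
  \<comment> \<open>The first renaming steps over the other candidate value; the second exchanges
    argument and value and steps over the image set \<open>b\<close>.\<close>
  have shift: "(\<lambda>i. case_nat y' (case_nat y w) (case_nat 0 (\<lambda>i. Suc (Suc i)) i)) = case_nat y' w"
    "(\<lambda>i. case_nat x (case_nat y (case_nat b w)) (case_nat (Suc 0) (case_nat 0 (\<lambda>i. Suc (Suc (Suc i)))) i)) =
      case_nat y (case_nat x w)" for x y y' b and w :: "nat \<Rightarrow> 'a"
    by (auto simp: fun_eq_iff split: nat.split)
  have "(\<forall>x. x \<epsilon> a \<longrightarrow> (\<forall>y y'. sat (\<epsilon>) (case_nat y (case_nat x (case_nat a v))) p \<and>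
      sat (\<epsilon>) (case_nat y' (case_nat x (case_nat a v))) p \<longrightarrow> y = y')) \<longrightarrow>
    (\<exists>b. \<forall>y. y \<epsilon> b \<longleftrightarrow> (\<exists>x. x \<epsilon> a \<and> sat (\<epsilon>) (case_nat y (case_nat x (case_nat a v))) p))"
    using s[of v] by (simp add: Replacement_def sat_rename shift numeral_eq_Suc)
  with assms show ?thesis by blast
qed

text \<open>A model is only a relation, so the set operations are chosen from the existence axioms;
  extensionality leaves a single candidate for each.\<close>

definition emp :: 'a where "emp = (SOME x. \<forall>z. \<not> z \<epsilon> x)"
definition upair :: "'a \<Rightarrow> 'a \<Rightarrow> 'a" where "upair x y = (SOME z. \<forall>w. w \<epsilon> z \<longleftrightarrow> w = x \<or> w = y)"
definition opair :: "'a \<Rightarrow> 'a \<Rightarrow> 'a" where "opair x y = upair (upair x x) (upair x y)"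
definition suc :: "'a \<Rightarrow> 'a" where "suc x = (SOME y. \<forall>w. w \<epsilon> y \<longleftrightarrow> w \<epsilon> x \<or> w = x)"

text \<open>Infinity supplies the empty set, as an inductive set is required to contain one.\<close>

lemma mem_emp: "\<not> z \<epsilon> emp"
proof -
  have "\<exists>x. \<forall>z. \<not> z \<epsilon> x"
    using sat_ZFC[of Infinity] by (simp add: ZFC_def Infinity_def Inductive_def Empty_def) blast
  then have "\<forall>z. \<not> z \<epsilon> emp" unfolding emp_def by (rule someI_ex)
  then show ?thesis ..
qed

lemma mem_upair: "w \<epsilon> upair x y \<longleftrightarrow> w = x \<or> w = y"
proof -
  have "\<exists>z. \<forall>w. w \<epsilon> z \<longleftrightarrow> w = x \<or> w = y"
    using sat_ZFC[of Pairing] by (simp add: ZFC_def Pairing_def UPair_def numeral_eq_Suc)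
  then have "\<forall>w. w \<epsilon> upair x y \<longleftrightarrow> w = x \<or> w = y" unfolding upair_def by (rule someI_ex)
  then show ?thesis ..
qed

lemma mem_suc: "w \<epsilon> suc x \<longleftrightarrow> w \<epsilon> x \<or> w = x"
proof -
  have "\<forall>a. \<exists>u. \<forall>z. z \<epsilon> u \<longleftrightarrow> (\<exists>y. y \<epsilon> a \<and> z \<epsilon> y)"
    using sat_ZFC[of Union_axiom] by (simp add: ZFC_def Union_axiom_def numeral_eq_Suc)
  \<comment> \<open>The successor is obtained as the union of \<open>{x, {x}}\<close>.\<close>
  then obtain u where "\<And>z. z \<epsilon> u \<longleftrightarrow> (\<exists>y. y \<epsilon> upair x (upair x x) \<and> z \<epsilon> y)" by metis
  then have "\<exists>y. \<forall>w. w \<epsilon> y \<longleftrightarrow> w \<epsilon> x \<or> w = x" by (intro exI[of _ u]) (auto simp: mem_upair)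
  then have "\<forall>w. w \<epsilon> suc x \<longleftrightarrow> w \<epsilon> x \<or> w = x" unfolding suc_def by (rule someI_ex)
  then show ?thesis ..
qed

lemma opair_eq_iff: "opair x y = opair x' y' \<longleftrightarrow> x = x' \<and> y = y'"
proof
  have u: "upair a b = upair c d \<longleftrightarrow> (a = c \<and> b = d) \<or> (a = d \<and> b = c)" for a b c d
    using mem_upair by (metis extensionality)
  assume "opair x y = opair x' y'"
  then show "x = x' \<and> y = y'" unfolding opair_def u by auto
qed simp

lemma sat_Empty [simp]: "sat (\<epsilon>) v (Empty i) \<longleftrightarrow> v i = emp"
  using mem_emp extensionality by (auto simp: Empty_def)

lemma sat_UPair [simp]: "sat (\<epsilon>) v (UPair i j k) \<longleftrightarrow> v k = upair (v i) (v j)"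
  using extensionality[of "v k" "upair (v i) (v j)"] by (auto simp: UPair_def mem_upair)

lemma sat_OPair [simp]: "sat (\<epsilon>) v (OPair i j k) \<longleftrightarrow> v k = opair (v i) (v j)"
  by (simp add: OPair_def opair_def numeral_2_eq_2)

lemma sat_Succ [simp]: "sat (\<epsilon>) v (Succ i j) \<longleftrightarrow> v j = suc (v i)"
  using extensionality[of "v j" "suc (v i)"] by (auto simp: Succ_def mem_suc)

section \<open>Natural numbers and integers of a model\<close>

definition is_inductive :: "'a \<Rightarrow> bool" where
  "is_inductive w \<longleftrightarrow> emp \<epsilon> w \<and> (\<forall>x. x \<epsilon> w \<longrightarrow> suc x \<epsilon> w)"

text \<open>These are the elements of the model's own omega, which may include others than the
  standard \<open>num k\<close>.\<close>

definition natural :: "'a \<Rightarrow> bool" where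
  "natural x \<longleftrightarrow> (\<forall>w. is_inductive w \<longrightarrow> x \<epsilon> w)"

lemma sat_Inductive [simp]: "sat (\<epsilon>) v (Inductive i) \<longleftrightarrow> is_inductive (v i)"
  by (simp add: Inductive_def is_inductive_def numeral_2_eq_2)

lemma sat_Natural [simp]: "sat (\<epsilon>) v (Natural i) \<longleftrightarrow> natural (v i)"
  by (simp add: Natural_def natural_def)

lemma natural_emp: "natural emp"
  by (simp add: natural_def is_inductive_def)

lemma natural_suc: "natural x \<Longrightarrow> natural (suc x)"
  by (simp add: natural_def is_inductive_def)

text \<open>Induction outside the model does not reach nonstandard numbers. Instead, Separation cuts
  out of an inductive set the elements of the desired form; the result is again inductive and
  therefore contains every natural number.\<close>

lemma natural_cases:
  assumes "natural x"
  obtains "x = emp" | y where "natural y" "x = suc y"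
proof -
  obtain w where w: "is_inductive w"
    using sat_ZFC[of Infinity] by (simp add: ZFC_def Infinity_def) blast
  have "\<exists>b. \<forall>x. x \<epsilon> b \<longleftrightarrow> x \<epsilon> w \<and> (x = emp \<or> (\<exists>y. natural y \<and> x = suc y))"
    using separation[of w _ "Dis (Empty 0) (Ex (Con (Natural 0) (Succ 0 1)))"] by simp
  then obtain b where b: "\<And>x. x \<epsilon> b \<longleftrightarrow> x \<epsilon> w \<and> (x = emp \<or> (\<exists>y. natural y \<and> x = suc y))"
    by blast
  have "is_inductive b"
    using w natural_emp natural_suc unfolding is_inductive_def b by blast
  then show thesis using assms b that unfolding natural_def by blast
qed

primrec num :: "nat \<Rightarrow> 'a" where
  "num 0 = emp"
| "num (Suc k) = suc (num k)"

lemma mem_num: "x \<epsilon> num n \<longleftrightarrow> (\<exists>m<n. x = num m)"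
  by (induction n) (auto simp: mem_emp mem_suc less_Suc_eq)

text \<open>The smaller of two numerals is an element of the larger, so equality would produce a set
  that is its own element.\<close>

lemma num_eq_iff: "num m = num n \<longleftrightarrow> m = n"
  using mem_num not_mem_self by (metis linorder_neqE_nat)

lemma sat_Numeral [simp]: "sat (\<epsilon>) v (Numeral k i) \<longleftrightarrow> v i = num k"
  by (induction k arbitrary: v i) auto

definition integer :: "'a \<Rightarrow> bool" where
  "integer x \<longleftrightarrow> (\<exists>m. natural m \<and> (x = opair m emp \<or> x = opair emp m))"

definition int_succ :: "'a \<Rightarrow> 'a \<Rightarrow> bool" where
  "int_succ x y \<longleftrightarrow> (\<exists>m. natural m \<and> (x = opair m emp \<and> y = opair (suc m) emp \<or>
     x = opair emp (suc m) \<and> y = opair emp m))"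

primrec int_add_nat :: "nat \<Rightarrow> 'a \<Rightarrow> 'a \<Rightarrow> bool" where
  "int_add_nat 0 x y \<longleftrightarrow> integer x \<and> x = y"
| "int_add_nat (Suc n) x y \<longleftrightarrow> (\<exists>z. int_succ x z \<and> int_add_nat n z y)"

definition int_add :: "int \<Rightarrow> 'a \<Rightarrow> 'a \<Rightarrow> bool" where
  "int_add c x y \<longleftrightarrow> (if c \<ge> 0 then int_add_nat (nat c) x y else int_add_nat (nat (- c)) y x)"

lemma sat_Integer [simp]: "sat (\<epsilon>) v (Integer i) \<longleftrightarrow> integer (v i)"
  by (auto simp: Integer_def integer_def numeral_2_eq_2)

lemma sat_Int_succ [simp]: "sat (\<epsilon>) v (Int_succ i j) \<longleftrightarrow> int_succ (v i) (v j)"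
  by (auto simp: Int_succ_def int_succ_def numeral_eq_Suc)

lemma sat_Int_add_nat [simp]: "sat (\<epsilon>) v (Int_add_nat n i j) \<longleftrightarrow> int_add_nat n (v i) (v j)"
  by (induction n arbitrary: v i j) auto

lemma sat_Int_add [simp]: "sat (\<epsilon>) v (Int_add c i j) \<longleftrightarrow> int_add c (v i) (v j)"
  by (simp add: Int_add_def int_add_def)

lemma int_succ_integer: "int_succ x y \<Longrightarrow> integer x \<and> integer y"
  unfolding int_succ_def integer_def using natural_suc by blast

text \<open>On the negative side, stepping up from \<open>opair emp m\<close> requires a predecessor
  of \<open>m\<close>, hence \<open>natural_cases\<close>. If \<open>m\<close> is
  \<open>emp\<close>, the integer is 0 and counts as nonnegative.\<close>

lemma int_succ_ex: "integer x \<Longrightarrow> \<exists>y. int_succ x y"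
  unfolding int_succ_def integer_def by (metis natural_cases)

lemma int_pred_ex: "integer y \<Longrightarrow> \<exists>x. int_succ x y"
  unfolding int_succ_def integer_def by (metis natural_cases)

lemma int_add_nat_ex: "integer x \<Longrightarrow> \<exists>y. int_add_nat n x y"
proof (induction n arbitrary: x)
  case (Suc n)
  then show ?case using int_succ_ex int_succ_integer by (metis int_add_nat.simps(2))
qed auto

lemma int_add_nat_integer: "int_add_nat n x y \<Longrightarrow> integer x"
  by (cases n) (auto dest: int_succ_integer)

lemma int_sub_nat_ex: "integer y \<Longrightarrow> \<exists>x. int_add_nat n x y"
proof (induction n)
  case (Suc n)
  then show ?case using int_pred_ex int_add_nat_integer by (metis int_add_nat.simps(2))
qed auto

text \<open>Because \<open>c\<close> is a genuine integer, induction outside the model suffices; a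
  negative \<open>c\<close> is realized by iterated predecessors.\<close>

lemma int_add_ex: "integer x \<Longrightarrow> \<exists>y. int_add c x y"
  by (cases "c \<ge> 0") (simp_all add: int_add_def int_add_nat_ex int_sub_nat_ex)

definition residue :: "nat \<Rightarrow> 'a \<Rightarrow> bool" where
  "residue N x \<longleftrightarrow> (\<exists>k<N. x = num k)"

definition residue_add :: "nat \<Rightarrow> int \<Rightarrow> 'a \<Rightarrow> 'a \<Rightarrow> bool" where
  "residue_add N b x y \<longleftrightarrow> (\<exists>k<N. x = num k \<and> y = num (nat ((int k + b) mod int N)))"

lemma sat_Residue [simp]: "sat (\<epsilon>) v (Residue N i) \<longleftrightarrow> residue N (v i)"
  by (auto simp: Residue_def residue_def)

lemma sat_Residue_add [simp]: "sat (\<epsilon>) v (Residue_add N b i j) \<longleftrightarrow> residue_add N b (v i) (v j)"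
  by (auto simp: Residue_add_def residue_add_def)

section \<open>Tuples, group elements and translations\<close>

primrec tuple :: "nat \<Rightarrow> (nat \<Rightarrow> 'a \<Rightarrow> bool) \<Rightarrow> 'a \<Rightarrow> bool" where
  "tuple 0 P x \<longleftrightarrow> x = emp"
| "tuple (Suc n) P x \<longleftrightarrow> (\<exists>t c. x = opair t c \<and> tuple n P t \<and> P n c)"

primrec tuple_rel :: "nat \<Rightarrow> (nat \<Rightarrow> 'a \<Rightarrow> 'a \<Rightarrow> bool) \<Rightarrow> 'a \<Rightarrow> 'a \<Rightarrow> bool" where
  "tuple_rel 0 R x y \<longleftrightarrow> x = emp \<and> y = emp"
| "tuple_rel (Suc n) R x y \<longleftrightarrow>
     (\<exists>t c t' c'. x = opair t c \<and> y = opair t' c' \<and> tuple_rel n R t t' \<and> R n c c')"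

lemma sat_Tuple:
  assumes "\<And>i v x. sat (\<epsilon>) v (p i x) \<longleftrightarrow> P i (v x)"
  shows "sat (\<epsilon>) v (Tuple n p x) \<longleftrightarrow> tuple n P (v x)"
  by (induction n arbitrary: v x) (simp_all add: assms numeral_2_eq_2)

lemma sat_Tuple_rel:
  assumes "\<And>i v x y. sat (\<epsilon>) v (p i x y) \<longleftrightarrow> R i (v x) (v y)"
  shows "sat (\<epsilon>) v (Tuple_rel n p x y) \<longleftrightarrow> tuple_rel n R (v x) (v y)"
  by (induction n arbitrary: v x y) (simp_all add: assms numeral_eq_Suc)

lemma tuple_cong: "(\<And>i c. i < n \<Longrightarrow> P i c \<longleftrightarrow> Q i c) \<Longrightarrow> tuple n P x \<longleftrightarrow> tuple n Q x"
  by (induction n arbitrary: x) auto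

lemma tuple_rel_cong:
  "(\<And>i c c'. i < n \<Longrightarrow> R i c c' \<longleftrightarrow> Q i c c') \<Longrightarrow> tuple_rel n R x y \<longleftrightarrow> tuple_rel n Q x y"
  by (induction n arbitrary: x y) auto

lemma tuple_rel_ex:
  assumes "\<And>i c. P i c \<Longrightarrow> \<exists>c'. R i c c'"
  shows "tuple n P x \<Longrightarrow> \<exists>y. tuple_rel n R x y"
proof (induction n arbitrary: x)
  case 0
  then show ?case by (intro exI[of _ emp]) simp
next
  case (Suc n)
  then obtain t c where x: "x = opair t c" "tuple n P t" "P n c" by auto
  obtain t' where "tuple_rel n R t t'" using Suc.IH x by blast
  moreover obtain c' where "R n c c'" using assms x by blast
  ultimately have "tuple_rel (Suc n) R x (opair t' c')" using x by auto
  then show ?case ..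
qed

definition in_group :: "nat \<Rightarrow> nat list \<Rightarrow> 'a \<Rightarrow> bool" where
  "in_group d Ns x \<longleftrightarrow> (\<exists>z t. x = opair z t \<and> tuple d (\<lambda>_. integer) z \<and>
     tuple (length Ns) (\<lambda>i. residue (Ns ! i)) t)"

definition translate :: "nat \<Rightarrow> nat list \<Rightarrow> elem \<Rightarrow> 'a \<Rightarrow> 'a \<Rightarrow> bool" where
  "translate d Ns f x y \<longleftrightarrow> (\<exists>z t z' t'. x = opair z t \<and> y = opair z' t' \<and>
     tuple_rel d (\<lambda>i. int_add (fst f i)) z z' \<and>
     tuple_rel (length Ns) (\<lambda>i. residue_add (Ns ! i) (snd f i)) t t')"

definition in_target :: "nat \<Rightarrow> nat list \<Rightarrow> (nat \<Rightarrow> int) set \<Rightarrow> 'a \<Rightarrow> bool" where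
  "in_target d Ns E0 y \<longleftrightarrow> (\<exists>z t. y = opair z t \<and> tuple d (\<lambda>_. integer) z \<and>
     (\<exists>a\<in>E0. tuple (length Ns) (\<lambda>i c. c = num (nat (a i))) t))"

lemma sat_In_group [simp]: "sat (\<epsilon>) v (In_group d Ns i) \<longleftrightarrow> in_group d Ns (v i)"
  by (simp add: In_group_def in_group_def numeral_2_eq_2
      sat_Tuple[where P = "\<lambda>_. integer"] sat_Tuple[where P = "\<lambda>i. residue (Ns ! i)"])

lemma sat_Translate [simp]: "sat (\<epsilon>) v (Translate d Ns f i j) \<longleftrightarrow> translate d Ns f (v i) (v j)"
  by (simp add: Translate_def translate_def numeral_eq_Suc
      sat_Tuple_rel[where R = "\<lambda>i. int_add (fst f i)"]
      sat_Tuple_rel[where R = "\<lambda>i. residue_add (Ns ! i) (snd f i)"])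

lemma sat_In_target [simp]:
  assumes "finite E0"
  shows "sat (\<epsilon>) v (In_target d Ns E0 i) \<longleftrightarrow> in_target d Ns E0 (v i)"
proof -
  have "sat (\<epsilon>) u (Tuple (length Ns) (\<lambda>i. Numeral (nat (a i))) x) \<longleftrightarrow>
      tuple (length Ns) (\<lambda>i c. c = num (nat (a i))) (u x)" for u x a
    by (rule sat_Tuple) simp
  with assms show ?thesis
    by (simp add: In_target_def in_target_def numeral_2_eq_2 sat_Tuple[where P = "\<lambda>_. integer"])
qed

lemma translate_ex: "in_group d Ns x \<Longrightarrow> \<exists>y. translate d Ns f x y"
proof -
  assume "in_group d Ns x"
  then obtain z t where x: "x = opair z t" "tuple d (\<lambda>_. integer) z"
    "tuple (length Ns) (\<lambda>i. residue (Ns ! i)) t" unfolding in_group_def by blast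
  have "\<exists>z'. tuple_rel d (\<lambda>i. int_add (fst f i)) z z'"
    using int_add_ex x(2) by (rule tuple_rel_ex)
  moreover have "\<exists>t'. tuple_rel (length Ns) (\<lambda>i. residue_add (Ns ! i) (snd f i)) t t'"
    by (rule tuple_rel_ex[OF _ x(3)]) (auto simp: residue_def residue_add_def)
  ultimately show ?thesis unfolding translate_def x(1) by blast
qed

section \<open>Solvability as read by a model\<close>

text \<open>These are the collections coded by an element of the model, precisely the range of its
  set variables.\<close>

definition definable :: "'a set \<Rightarrow> bool" where
  "definable A \<longleftrightarrow> (\<exists>a. A = {x. x \<epsilon> a})"

lemma sat_In_sum [simp]:
  "finite F \<Longrightarrow> sat (\<epsilon>) v (In_sum d Ns F j k i) \<longleftrightarrow>
     tile_sum (translate d Ns) F {x. x \<epsilon> v (j - 1 + k)} (v i)"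
  by (auto simp: In_sum_def tile_sum_def)

text \<open>\<open>Solvable\<close> states membership in the group once for the whole system, while
  \<open>tiles\<close> repeats it in every equation; this is why the clause appears beside the
  formula.\<close>

lemma sat_Tile_equation:
  assumes F: "\<And>j. j \<in> {1..J} \<Longrightarrow> finite (F j)" and E0: "finite E0"
  shows "(\<forall>j\<in>{1..J}. \<forall>x. x \<epsilon> v (j - 1) \<longrightarrow> in_group d Ns x) \<and>
      sat (\<epsilon>) v (Tile_equation d Ns J F E0) \<longleftrightarrow>
    tiles (in_group d Ns) (translate d Ns) J F (in_target d Ns E0) (\<lambda>j. {x. x \<epsilon> v (j - 1)})"
proof -
  let ?X = "\<lambda>j. {x. x \<epsilon> v (j - 1)}"
  have J: "set [1..<Suc J] = {1..J}" by auto
  have 1: "sat (\<epsilon>) v (Sums_distinct d Ns (F j) j) \<longleftrightarrow>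
     (\<forall>f\<in>F j. \<forall>f'\<in>F j. \<forall>x\<in>?X j. \<forall>x'\<in>?X j. \<forall>y.
        translate d Ns f x y \<longrightarrow> translate d Ns f' x' y \<longrightarrow> f = f' \<and> x = x')"
    if "j \<in> {1..J}" for j
  proof -
    \<comment> \<open>Equality of tile elements is decided outside the model, before the formula is
      formed.\<close>
    have "sat (\<epsilon>) w (if f = f' then Eq 2 1 else Fls) \<longleftrightarrow> f = f' \<and> w 2 = w 1"
      for w and f f' :: elem by simp
    then show ?thesis
      using F[OF that] by (simp add: Sums_distinct_def numeral_eq_Suc) blast
  qed
  have 2: "sat (\<epsilon>) v (Neg (Ex (Con (In_sum d Ns (F i) i 1 0) (In_sum d Ns (F j) j 1 0)))) \<longleftrightarrow>
      \<not> (\<exists>y. tile_sum (translate d Ns) (F i) (?X i) y \<and> tile_sum (translate d Ns) (F j) (?X j) y)"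
    if "i \<in> {1..J}" "j \<in> {1..J}" for i j
    using F[OF that(1)] F[OF that(2)] by simp
  have 3: "sat (\<epsilon>) v (All (Iff (Dis_list (map (\<lambda>j. In_sum d Ns (F j) j 1 0) [1..<Suc J]))
        (In_target d Ns E0 0))) \<longleftrightarrow>
      (\<forall>y. (\<exists>j\<in>{1..J}. tile_sum (translate d Ns) (F j) (?X j) y) \<longleftrightarrow> in_target d Ns E0 y)"
  proof -
    have "(\<exists>j\<in>{1..J}. sat (\<epsilon>) (case_nat y v) (In_sum d Ns (F j) j 1 0)) \<longleftrightarrow>
        (\<exists>j\<in>{1..J}. tile_sum (translate d Ns) (F j) (?X j) y)" for y
      by (rule bex_cong) (auto simp: F split: nat.split)
    then show ?thesis using E0 by (simp only: sat.simps sat_connectives sat_Dis_list set_map J) simp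
  qed
  have "sat (\<epsilon>) v (Tile_equation d Ns J F E0) \<longleftrightarrow>
    (\<forall>j\<in>{1..J}. sat (\<epsilon>) v (Sums_distinct d Ns (F j) j)) \<and>
    (\<forall>i\<in>{1..J}. \<forall>j\<in>{1..J}. i \<noteq> j \<longrightarrow>
       sat (\<epsilon>) v (Neg (Ex (Con (In_sum d Ns (F i) i 1 0) (In_sum d Ns (F j) j 1 0))))) \<and>
    sat (\<epsilon>) v (All (Iff (Dis_list (map (\<lambda>j. In_sum d Ns (F j) j 1 0) [1..<Suc J]))
        (In_target d Ns E0 0)))"
    unfolding Tile_equation_def
    by (simp only: sat_Con_list list.set set_map J ball_simps ball_set_distinct_pairs simp_thms)
  also have "\<dots> \<longleftrightarrow>
    (\<forall>j\<in>{1..J}. \<forall>f\<in>F j. \<forall>f'\<in>F j. \<forall>x\<in>?X j. \<forall>x'\<in>?X j. \<forall>y.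
        translate d Ns f x y \<longrightarrow> translate d Ns f' x' y \<longrightarrow> f = f' \<and> x = x') \<and>
    (\<forall>i\<in>{1..J}. \<forall>j\<in>{1..J}. i \<noteq> j \<longrightarrow>
      \<not> (\<exists>y. tile_sum (translate d Ns) (F i) (?X i) y \<and> tile_sum (translate d Ns) (F j) (?X j) y)) \<and>
    (\<forall>y. (\<exists>j\<in>{1..J}. tile_sum (translate d Ns) (F j) (?X j) y) \<longleftrightarrow> in_target d Ns E0 y)"
    unfolding 3 by (simp only: 1 2 cong: ball_cong)
  finally show ?thesis unfolding tiles_def by simp
qed

lemma sat_Solvable:
  assumes M: "M \<ge> 1"
    and F: "\<And>m j. m \<in> {1..M} \<Longrightarrow> j \<in> {1..J} \<Longrightarrow> finite (F m j)"
    and E0: "\<And>m. m \<in> {1..M} \<Longrightarrow> finite (E0 m)"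
  shows "sat (\<epsilon>) v (Solvable d Ns J M F E0) \<longleftrightarrow>
    (\<exists>X. (\<forall>m\<in>{1..M}. tiles (in_group d Ns) (translate d Ns) J (F m) (in_target d Ns (E0 m)) X) \<and>
      (\<forall>j\<in>{1..J}. definable (X j)))"
proof -
  let ?tiles = "\<lambda>m. tiles (in_group d Ns) (translate d Ns) J (F m) (in_target d Ns (E0 m))"
  let ?X = "\<lambda>w j. {x. x \<epsilon> w (j - 1)}"
  have set: "set [1..<Suc n] = {1..n}" for n by auto
  have grp: "sat (\<epsilon>) w (All (Imp (Mem 0 (j - 1 + 1)) (In_group d Ns 0))) \<longleftrightarrow>
      (\<forall>x. x \<epsilon> w (j - 1) \<longrightarrow> in_group d Ns x)" for w j by simp
  have "sat (\<epsilon>) v (Solvable d Ns J M F E0) \<longleftrightarrow> (\<exists>w. (\<forall>i. w (i + J) = v i) \<and>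
      (\<forall>j\<in>{1..J}. \<forall>x. x \<epsilon> w (j - 1) \<longrightarrow> in_group d Ns x) \<and>
      (\<forall>m\<in>{1..M}. sat (\<epsilon>) w (Tile_equation d Ns J (F m) (E0 m))))"
    unfolding Solvable_def sat_Ex_power
    by (simp only: sat_connectives sat_Con_list set_map set ball_simps grp)
  also have "\<dots> \<longleftrightarrow> (\<exists>w. (\<forall>i. w (i + J) = v i) \<and> (\<forall>m\<in>{1..M}. ?tiles m (?X w)))"
  proof -
    have t: "?tiles m (?X w) \<longleftrightarrow> (\<forall>j\<in>{1..J}. \<forall>x. x \<epsilon> w (j - 1) \<longrightarrow> in_group d Ns x) \<and>
        sat (\<epsilon>) w (Tile_equation d Ns J (F m) (E0 m))" if "m \<in> {1..M}" for m w
      by (rule sat_Tile_equation[symmetric]) (use F E0 that in auto)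
    \<comment> \<open>One equation suffices to recover the common membership clause from
      \<open>tiles\<close>.\<close>
    have "1 \<in> {1..M}" using M by simp
    then have "(\<forall>m\<in>{1..M}. ?tiles m (?X w)) \<longleftrightarrow>
      (\<forall>j\<in>{1..J}. \<forall>x. x \<epsilon> w (j - 1) \<longrightarrow> in_group d Ns x) \<and>
      (\<forall>m\<in>{1..M}. sat (\<epsilon>) w (Tile_equation d Ns J (F m) (E0 m)))" for w
      using t by blast
    then show ?thesis by simp
  qed
  also have "\<dots> \<longleftrightarrow> (\<exists>X. (\<forall>m\<in>{1..M}. ?tiles m X) \<and> (\<forall>j\<in>{1..J}. definable (X j)))"
  proof
    assume "\<exists>w. (\<forall>i. w (i + J) = v i) \<and> (\<forall>m\<in>{1..M}. ?tiles m (?X w))"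
    then obtain w where "\<forall>m\<in>{1..M}. ?tiles m (?X w)" by blast
    then show "\<exists>X. (\<forall>m\<in>{1..M}. ?tiles m X) \<and> (\<forall>j\<in>{1..J}. definable (X j))"
      by (intro exI[of _ "?X w"]) (auto simp: definable_def)
  next
    assume "\<exists>X. (\<forall>m\<in>{1..M}. ?tiles m X) \<and> (\<forall>j\<in>{1..J}. definable (X j))"
    then obtain X where X: "\<forall>m\<in>{1..M}. ?tiles m X" "\<forall>j\<in>{1..J}. definable (X j)" by blast
    then obtain a where a: "\<And>j. j \<in> {1..J} \<Longrightarrow> X j = {x. x \<epsilon> a j}"
      unfolding definable_def by metis
    \<comment> \<open>Since index \<open>j - 1\<close> stands for the \<open>j\<close>-th unknown,
      the code stored at \<open>i\<close> is that of number \<open>Suc i\<close>.\<close>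
    define w where "w i = (if i < J then a (Suc i) else v (i - J))" for i
    have "?tiles m (?X w) \<longleftrightarrow> ?tiles m X" for m
      by (rule tiles_cong) (auto simp: w_def a)
    then have "(\<forall>i. w (i + J) = v i) \<and> (\<forall>m\<in>{1..M}. ?tiles m (?X w))"
      using X(1) by (simp add: w_def)
    then show "\<exists>w. (\<forall>i. w (i + J) = v i) \<and> (\<forall>m\<in>{1..M}. ?tiles m (?X w))" by blast
  qed
  finally show ?thesis .
qed

section \<open>Appending a residue inside a model\<close>

definition is_pair :: "'a \<Rightarrow> bool" where
  "is_pair x \<longleftrightarrow> (\<exists>z t. x = opair z t)"

text \<open>Sends \<open>(z, t)\<close> to \<open>(z, (t, k))\<close>; junk on arguments that are not pairs.\<close>

definition append_num :: "nat \<Rightarrow> 'a \<Rightarrow> 'a" where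
  "append_num k x = (THE u. \<exists>z t. x = opair z t \<and> u = opair z (opair t (num k)))"

lemma append_num_opair [simp]: "append_num k (opair z t) = opair z (opair t (num k))"
  by (simp add: append_num_def opair_eq_iff)

lemma append_num_inj:
  "is_pair x \<Longrightarrow> is_pair x' \<Longrightarrow> append_num k x = append_num k' x' \<Longrightarrow> k = k' \<and> x = x'"
  by (auto simp: is_pair_def opair_eq_iff num_eq_iff)

lemma in_group_is_pair: "in_group d Ns x \<Longrightarrow> is_pair x"
  by (auto simp: in_group_def is_pair_def)

lemma translate_is_pair: "translate d Ns f x y \<Longrightarrow> is_pair x \<and> is_pair y"
  by (auto simp: translate_def is_pair_def)

lemma in_target_is_pair: "in_target d Ns E0 y \<Longrightarrow> is_pair y"
  by (auto simp: in_target_def is_pair_def)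

text \<open>Tuples nest to the left with the last coordinate outermost, so an extra modulus wraps
  one more pair around the old tuple and leaves its inside untouched.\<close>

lemma in_group_append:
  "in_group d (Ns @ [N]) u \<longleftrightarrow> (\<exists>x k. in_group d Ns x \<and> k < N \<and> u = append_num k x)"
proof -
  have "tuple (length Ns) (\<lambda>i. residue ((Ns @ [N]) ! i)) t \<longleftrightarrow>
      tuple (length Ns) (\<lambda>i. residue (Ns ! i)) t" for t
    by (rule tuple_cong) (simp add: nth_append)
  then have "in_group d (Ns @ [N]) u \<longleftrightarrow> (\<exists>z t k. u = opair z (opair t (num k)) \<and>
      tuple d (\<lambda>_. integer) z \<and> tuple (length Ns) (\<lambda>i. residue (Ns ! i)) t \<and> k < N)"
    unfolding in_group_def by (simp add: residue_def) blast
  also have "\<dots> \<longleftrightarrow> (\<exists>x k. in_group d Ns x \<and> k < N \<and> u = append_num k x)"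
    unfolding in_group_def by (metis append_num_opair)
  finally show ?thesis .
qed

text \<open>As \<open>m < N\<close>, the residue stored in the lifted element is \<open>m\<close>
  itself; the outermost coordinate moves from \<open>k\<close> to \<open>(k + m) mod N\<close> and
  the others are translated by \<open>f\<close>.\<close>

lemma translate_layer:
  assumes "m < N"
  shows "translate d (Ns @ [N]) (layer Ns N m f) u v \<longleftrightarrow> (\<exists>x y k. k < N \<and> translate d Ns f x y \<and>
    u = append_num k x \<and> v = append_num ((k + m) mod N) y)"
proof -
  let ?R = "\<lambda>i. residue_add (Ns ! i) (snd f i)"
  let ?Z = "tuple_rel d (\<lambda>i. int_add (fst f i))"
  have l: "fst (layer Ns N m f) = fst f" "snd (layer Ns N m f) (length Ns) = int m"
    "\<And>i. i \<noteq> length Ns \<Longrightarrow> snd (layer Ns N m f) i = snd f i"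
    using assms by (simp_all add: layer_def append_residue_def split: prod.split)
  have r: "tuple_rel (length Ns) (\<lambda>i. residue_add ((Ns @ [N]) ! i) (snd (layer Ns N m f) i)) t t' \<longleftrightarrow>
      tuple_rel (length Ns) ?R t t'" for t t'
    by (rule tuple_rel_cong) (simp add: nth_append l)
  have "nat ((int k + int m) mod int N) = (k + m) mod N" for k
    by (simp add: nat_mod_distrib nat_add_distrib)
  then have a: "residue_add N (int m) c c' \<longleftrightarrow> (\<exists>k<N. c = num k \<and> c' = num ((k + m) mod N))" for c c'
    by (simp add: residue_add_def)
  have "translate d (Ns @ [N]) (layer Ns N m f) u v \<longleftrightarrow> (\<exists>z t z' t' k.
      u = opair z (opair t (num k)) \<and> v = opair z' (opair t' (num ((k + m) mod N))) \<and>
      ?Z z z' \<and> tuple_rel (length Ns) ?R t t' \<and> k < N)"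
    unfolding translate_def by (simp add: l r a) blast
  also have "\<dots> \<longleftrightarrow> (\<exists>x y k. k < N \<and> translate d Ns f x y \<and>
      u = append_num k x \<and> v = append_num ((k + m) mod N) y)" (is "?A \<longleftrightarrow> ?B")
  proof
    assume ?A
    then obtain z t z' t' k where "u = opair z (opair t (num k))"
      "v = opair z' (opair t' (num ((k + m) mod N)))"
      "?Z z z'" "tuple_rel (length Ns) ?R t t'" "k < N" by blast
    then show ?B
      by (intro exI[of _ "opair z t"] exI[of _ "opair z' t'"] exI[of _ k])
        (auto simp: translate_def)
  next
    assume ?B
    then obtain x y k where k: "k < N" "u = append_num k x" "v = append_num ((k + m) mod N) y"
      and "translate d Ns f x y" by blast
    then obtain z t z' t' where "x = opair z t" "y = opair z' t'" "?Z z z'"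
      "tuple_rel (length Ns) ?R t t'" unfolding translate_def by blast
    with k show ?A by (intro exI[of _ z] exI[of _ t] exI[of _ z'] exI[of _ t'] exI[of _ k]) simp
  qed
  finally show ?thesis .
qed

lemma in_target_stacked:
  assumes "M < N"
  shows "in_target d (Ns @ [N]) (stacked_set Ns N M E0) v \<longleftrightarrow>
    (\<exists>m\<in>{1..M}. \<exists>y. in_target d Ns (E0 m) y \<and> v = append_num m y)"
proof -
  let ?T = "\<lambda>a. tuple (length Ns) (\<lambda>i c. c = num (nat (a i)))"
  have r: "?T (append_residue Ns N a m) t \<longleftrightarrow> ?T a t" for a m t
    by (rule tuple_cong) (simp add: append_residue_def)
  have "nat (append_residue Ns N a m (length Ns)) = m" if "m \<in> {1..M}" for a m
    using that assms by (simp add: append_residue_def)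
  then have "in_target d (Ns @ [N]) (stacked_set Ns N M E0) v \<longleftrightarrow> (\<exists>m\<in>{1..M}. \<exists>z t.
      v = opair z (opair t (num m)) \<and> tuple d (\<lambda>_. integer) z \<and> (\<exists>a\<in>E0 m. ?T a t))"
    unfolding in_target_def stacked_set_def by (simp add: r) blast
  also have "\<dots> \<longleftrightarrow> (\<exists>m\<in>{1..M}. \<exists>y. in_target d Ns (E0 m) y \<and> v = append_num m y)"
    unfolding in_target_def by (metis append_num_opair)
  finally show ?thesis .
qed

text \<open>A mixed instance: points belong to the model, while tile elements are taken from the
  genuine group.\<close>

lemma stacking_model:
  assumes "M < N"
  shows "stacking is_pair (in_group d Ns) (translate d Ns) (carrier (explicit_group d Ns))
    (in_group d (Ns @ [N])) (translate d (Ns @ [N])) append_num (layer Ns N) M N"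
proof
  show "M < N" by fact
next
  fix x assume "in_group d Ns x"
  then show "is_pair x" by (rule in_group_is_pair)
next
  fix f x y assume "translate d Ns f x y"
  then show "is_pair x \<and> is_pair y" by (rule translate_is_pair)
next
  fix k k' x x' assume "is_pair x" "is_pair x'" "append_num k x = append_num k' x'"
  then show "k = k' \<and> x = x'" by (rule append_num_inj)
next
  fix u show "in_group d (Ns @ [N]) u \<longleftrightarrow> (\<exists>x k. in_group d Ns x \<and> k < N \<and> u = append_num k x)"
    by (rule in_group_append)
next
  fix f :: elem and m u v assume "m \<in> {1..M}"
  then have "m < N" using assms by simp
  then show "translate d (Ns @ [N]) (layer Ns N m f) u v \<longleftrightarrow> (\<exists>x y k. k < N \<and> translate d Ns f x y \<and>
      u = append_num k x \<and> v = append_num ((k + m) mod N) y)"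
    by (rule translate_layer)
next
  fix f f' m m'
  assume f: "f \<in> carrier (explicit_group d Ns)" "f' \<in> carrier (explicit_group d Ns)"
    and m: "m \<in> {1..M}" "m' \<in> {1..M}" and e: "layer Ns N m f = layer Ns N m' f'"
  have "m < N" "m' < N" using m assms by auto
  from layer_inj[OF f this e] show "m = m' \<and> f = f'" .
next
  fix f x assume "in_group d Ns x"
  then show "\<exists>y. translate d Ns f x y" by (rule translate_ex)
qed

text \<open>\<open>i = (z, t)\<close> and \<open>j = (z, (t, 0))\<close> for some \<open>z\<close> and \<open>t\<close>\<close>

definition Append_zero :: "nat \<Rightarrow> nat \<Rightarrow> fm" where
  "Append_zero i j = Ex (Ex (Ex (Ex (Con_list
     [OPair 3 2 (i+4), OPair 3 1 (j+4), OPair 2 0 1, Empty 0]))))"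

lemma sat_Append_zero:
  "sat (\<epsilon>) v (Append_zero i j) \<longleftrightarrow> is_pair (v i) \<and> v j = append_num 0 (v i)"
  by (auto simp: Append_zero_def is_pair_def numeral_eq_Suc) blast

text \<open>Appending the residue 0 is given by a formula, so Replacement yields a code for the
  image; as the map is injective, Replacement along its inverse leads back.\<close>

lemma definable_append_num_iff:
  assumes "\<forall>x\<in>A. is_pair x"
  shows "definable (append_num 0 ` A) \<longleftrightarrow> definable A"
proof
  assume "definable A"
  then obtain a where a: "A = {x. x \<epsilon> a}" unfolding definable_def by blast
  have "\<exists>b. \<forall>y. y \<epsilon> b \<longleftrightarrow> (\<exists>x. x \<epsilon> a \<and> is_pair x \<and> y = append_num 0 x)"
    using replacement[of a _ "Append_zero 1 0"] by (simp add: sat_Append_zero)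
  then obtain b where "\<And>y. y \<epsilon> b \<longleftrightarrow> (\<exists>x. x \<epsilon> a \<and> is_pair x \<and> y = append_num 0 x)" by blast
  then have "append_num 0 ` A = {y. y \<epsilon> b}" using assms a by auto
  then show "definable (append_num 0 ` A)" unfolding definable_def by blast
next
  assume "definable (append_num 0 ` A)"
  then obtain a where a: "append_num 0 ` A = {x. x \<epsilon> a}" unfolding definable_def by blast
  have "y = y'" if "is_pair y" "is_pair y'" "append_num 0 y = append_num 0 y'" for y y'
    using append_num_inj that by blast
  then have "\<exists>b. \<forall>y. y \<epsilon> b \<longleftrightarrow> (\<exists>x. x \<epsilon> a \<and> is_pair y \<and> x = append_num 0 y)"
    \<comment> \<open>The formula is read from image to source; that it is functional in this
      direction is the injectivity just stated.\<close>
    using replacement[of a _ "Append_zero 0 1"] by (simp add: sat_Append_zero)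
  then obtain b where b: "\<And>y. y \<epsilon> b \<longleftrightarrow> (\<exists>x. x \<epsilon> a \<and> is_pair y \<and> x = append_num 0 y)" by blast
  have "y \<in> A \<longleftrightarrow> y \<epsilon> b" for y
  proof -
    have "y \<epsilon> b \<longleftrightarrow> is_pair y \<and> append_num 0 y \<in> append_num 0 ` A" unfolding b a by auto
    also have "\<dots> \<longleftrightarrow> y \<in> A" using assms append_num_inj by blast
    finally show ?thesis ..
  qed
  then have "A = {y. y \<epsilon> b}" by blast
  then show "definable A" unfolding definable_def by blast
qed

lemma sat_Solvable_stacked_iff:
  assumes M: "M \<ge> 1" "N > M"
    and F: "\<And>m j. m \<in> {1..M} \<Longrightarrow> j \<in> {1..J} \<Longrightarrow>
      finite (F m j) \<and> F m j \<noteq> {} \<and> F m j \<subseteq> carrier (explicit_group d Ns)"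
    and E0: "\<And>m. m \<in> {1..M} \<Longrightarrow> finite (E0 m)"
  shows "sat (\<epsilon>) v (Solvable d (Ns @ [N]) J 1 (\<lambda>_. stacked_tile Ns N M F) (\<lambda>_. stacked_set Ns N M E0))
    \<longleftrightarrow> sat (\<epsilon>) v (Solvable d Ns J M F E0)"
proof -
  let ?F = "\<lambda>j. \<Union>m\<in>{1..M}. layer Ns N m ` F m j"
  interpret stacking is_pair "in_group d Ns" "translate d Ns" "carrier (explicit_group d Ns)"
    "in_group d (Ns @ [N])" "translate d (Ns @ [N])" append_num "layer Ns N" M N
    using M(2) by (rule stacking_model)
  have F': "stacked_tile Ns N M F = ?F" by (auto simp: fun_eq_iff stacked_tile_def layer_def)
  have T: "in_target d (Ns @ [N]) (stacked_set Ns N M E0) =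
      (\<lambda>v. \<exists>m\<in>{1..M}. \<exists>y. in_target d Ns (E0 m) y \<and> v = append_num m y)"
    using in_target_stacked[OF M(2)] by (simp add: fun_eq_iff)
  have "finite (?F j)" if "j \<in> {1..J}" for j using F that by auto
  moreover have "finite (stacked_set Ns N M E0)" using E0 by (auto simp: stacked_set_def)
  ultimately have "sat (\<epsilon>) v (Solvable d (Ns @ [N]) J 1 (\<lambda>_. stacked_tile Ns N M F)
        (\<lambda>_. stacked_set Ns N M E0)) \<longleftrightarrow>
    (\<exists>Y. tiles (in_group d (Ns @ [N])) (translate d (Ns @ [N])) J ?F
        (in_target d (Ns @ [N]) (stacked_set Ns N M E0)) Y \<and> (\<forall>j\<in>{1..J}. definable (Y j)))"
    unfolding F' by (subst sat_Solvable) simp_all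
  also have "\<dots> \<longleftrightarrow> (\<exists>X. (\<forall>m\<in>{1..M}. tiles (in_group d Ns) (translate d Ns) J (F m)
        (in_target d Ns (E0 m)) X) \<and> (\<forall>j\<in>{1..J}. definable (X j)))"
    unfolding T
  proof (rule stacked_solution_iff)
    fix A assume "\<forall>x\<in>A. in_group d Ns x"
    then show "definable (append_num 0 ` A) \<longleftrightarrow> definable A"
      using definable_append_num_iff in_group_is_pair by blast
  next
    fix m y assume "in_target d Ns (E0 m) y"
    then show "is_pair y" by (rule in_target_is_pair)
  qed (use F M in auto)
  also have "\<dots> \<longleftrightarrow> sat (\<epsilon>) v (Solvable d Ns J M F E0)"
    using F E0 M by (subst sat_Solvable) auto
  finally show ?thesis .
qed

end

section \<open>From truth in models to provability\<close>

text \<open>Modulus 0 would give the infinite group of integers. Finiteness of the target sets is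
  what gives the disjunction in \<open>In_target\<close> its intended meaning.\<close>

lemma finite_explicit_finite_group:
  assumes "\<forall>n\<in>set Ns. n > 0"
  shows "finite (carrier (explicit_finite_group Ns))"
  unfolding explicit_finite_group_def using assms
  by (auto intro!: finite_PiE simp: carrier_integer_mod_group)

text \<open>Completeness proves both implications inside ZFC. Applied to the negated sentences as
  well, it handles refutability in the same way as provability.\<close>

lemma ZFC_derives_iff:
  assumes "\<And>(E :: nat \<Rightarrow> nat \<Rightarrow> bool) v. (\<And>a w. a \<in> ZFC \<Longrightarrow> sat E w a) \<Longrightarrow> sat E v p \<longleftrightarrow> sat E v q"
  shows "ZFC \<turnstile> p \<longleftrightarrow> ZFC \<turnstile> q"
proof -
  have "ZFC \<turnstile> Imp p q" by (rule ZFC_complete) (simp add: assms)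
  moreover have "ZFC \<turnstile> Imp q p" by (rule ZFC_complete) (simp add: assms)
  ultimately show ?thesis using derives.ImpE by blast
qed

theorem theorem1p14:
  fixes d J M N :: nat and Ns :: "nat list"
    and F :: "nat \<Rightarrow> nat \<Rightarrow> elem set" and E0 :: "nat \<Rightarrow> (nat \<Rightarrow> int) set"
  assumes "J \<ge> 1" and "M \<ge> 1" and "N > M"
    and "\<forall>n\<in>set Ns. n > 0"
    and "\<forall>m\<in>{1..M}. \<forall>j\<in>{1..J}.
           finite (F m j) \<and> F m j \<noteq> {} \<and> F m j \<subseteq> carrier (explicit_group d Ns)"
    and "\<forall>m\<in>{1..M}. E0 m \<subseteq> carrier (explicit_finite_group Ns)"
  shows "(aperiodic_system d Ns J M F E0 \<longleftrightarrow>
            aperiodic_tile d (Ns @ [N]) J (stacked_tile Ns N M F) (stacked_set Ns N M E0)) \<and>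
         (undecidable_system d Ns J M F E0 \<longleftrightarrow>
            undecidable_tile d (Ns @ [N]) J (stacked_tile Ns N M F) (stacked_set Ns N M E0)) \<and>
         (independent_system d Ns J M F E0 \<longleftrightarrow>
            independent_tile d (Ns @ [N]) J (stacked_tile Ns N M F) (stacked_set Ns N M E0))"
proof -
  let ?p = "Solvable d Ns J M F E0"
  let ?q = "Solvable d (Ns @ [N]) J 1 (\<lambda>_. stacked_tile Ns N M F) (\<lambda>_. stacked_set Ns N M E0)"
  have E0: "finite (E0 m)" if "m \<in> {1..M}" for m
    using assms(6) finite_explicit_finite_group[OF assms(4)] that finite_subset by blast
  have sat: "sat E v ?q \<longleftrightarrow> sat E v ?p"
    if "\<And>a w. a \<in> ZFC \<Longrightarrow> sat E w a" for E :: "nat \<Rightarrow> nat \<Rightarrow> bool" and v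
  proof -
    interpret zfc_model E by unfold_locales (rule that)
    show ?thesis using assms E0 by (intro sat_Solvable_stacked_iff) auto
  qed
  have "ZFC \<turnstile> ?q \<longleftrightarrow> ZFC \<turnstile> ?p"
    by (rule ZFC_derives_iff) (rule sat)
  moreover have "ZFC \<turnstile> Neg ?q \<longleftrightarrow> ZFC \<turnstile> Neg ?p"
    by (rule ZFC_derives_iff) (simp only: sat_connectives sat)
  moreover have "aperiodic_system d Ns J M F E0 \<longleftrightarrow>
      aperiodic_tile d (Ns @ [N]) J (stacked_tile Ns N M F) (stacked_set Ns N M E0)"
    using assms by (intro aperiodic_stacked_iff[symmetric]) auto
  ultimately show ?thesis
    unfolding undecidable_system_def undecidable_tile_def independent_system_def independent_tile_def
    by simp
qed

end
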